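(* Let $r\in\mathbb{N}$ and let $\tau\colon\mathbb{N}\to\{1,\ldots,r\}$ be a type map. For each type $\theta\in\{1,\ldots,r\}$ let $w_\theta\ge 0$ be a weight and $F_\theta$ an absolutely continuous distribution on $\mathbb{R}$ with density $f_\theta$. Let $\lambda_1,\lambda_2,\ldots$ be mutually independent random variables such that $\lambda_j$ has density $f_{\tau(j)}$, and give representative $j$ the weight $w_j=w_{\tau(j)}$. For $m\in\mathbb{N}$ let $\beta_\theta(m)=|\{k\in\{1,\ldots,m\}:\tau(k)=\theta\}|/m$, and suppose there exist $\beta>0$ and $m^0\in\mathbb{N}$ with $\beta_\theta(m)\ge\beta$ for all $\theta$ and all $m\ge m^0$. Suppose every $F_\theta$ has the same median $\mathrm{M}$, $f_\theta(\mathrm{M})>0$, and there are $\varepsilon_1>0$ and $c\ge 0$ such that $|f_\theta(x)-f_\theta(\mathrm{M})|\le c(x-\mathrm{M})^2$ for all $x\in[\mathrm{M}-\varepsilon_1,\mathrm{M}+\varepsilon_1]$ and all $\theta$. Then for all $i,j\in\mathbb{N}$ with $w_j>0$, $$\lim_{m\to\infty}\frac{\pi_i(\mathcal{R}^m)}{\pi_j(\mathcal{R}^m)}=\frac{w_i\,f_{\tau(i)}(\mathrm{M})}{w_j\,f_{\tau(j)}(\mathrm{M})}.$$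
   Context: For each $m$, the assembly $\mathcal{R}^m$ consists of representatives $1,\ldots,m$ with ideal points $\lambda_1,\ldots,\lambda_m$ and weights $w_1,\ldots,w_m$, and uses quota $q^m=\tfrac12\sum_{j=1}^m w_j$. Almost surely the $\lambda_j$ are distinct; let $k{:}m$ denote the (random) index of the representative with the $k$-th smallest ideal point among $\lambda_1,\ldots,\lambda_m$, and $w_{k:m}$ its weight. The pivotal position is $P=\min\{j\in\{1,\ldots,m\}:\sum_{k=1}^j w_{k:m}>q^m\}$, and the pivot probability of representative $i$ is $\pi_i(\mathcal{R}^m)=\Pr(P{:}m=i)$, i.e. the probability that $\lambda_i$ is the weighted median (the outcome) of $\mathcal{R}^m$. *)

theory Defs
  imports "HOL-Probability.Probability"
begin

text \<open>Representatives are indexed by 1, 2, ...; the assembly R^m consists of 1..m.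
  lam k w is the ideal point of representative k, wt k its weight.\<close>

definition quota :: "(nat \<Rightarrow> real) \<Rightarrow> nat \<Rightarrow> real" where
  "quota wt m = (\<Sum>j=1..m. wt j) / 2"

text \<open>k:m, the index of the representative with the k-th smallest ideal point
  among lam 1, ..., lam m (well defined when these values are distinct).\<close>
definition ord_idx :: "(nat \<Rightarrow> 'a \<Rightarrow> real) \<Rightarrow> nat \<Rightarrow> 'a \<Rightarrow> nat \<Rightarrow> nat" where
  "ord_idx lam m \<omega> k =
     (THE i. i \<in> {1..m} \<and> card {l \<in> {1..m}. lam l \<omega> < lam i \<omega>} = k - 1)"

definition pivot_pos :: "(nat \<Rightarrow> 'a \<Rightarrow> real) \<Rightarrow> (nat \<Rightarrow> real) \<Rightarrow> nat \<Rightarrow> 'a \<Rightarrow> nat" where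
  "pivot_pos lam wt m \<omega> =
     (LEAST j. j \<in> {1..m} \<and> (\<Sum>k=1..j. wt (ord_idx lam m \<omega> k)) > quota wt m)"

definition pivot_prob :: "'a measure \<Rightarrow> (nat \<Rightarrow> 'a \<Rightarrow> real) \<Rightarrow> (nat \<Rightarrow> real) \<Rightarrow> nat \<Rightarrow> nat \<Rightarrow> real" where
  "pivot_prob M lam wt m i =
     measure M {\<omega> \<in> space M. ord_idx lam m \<omega> (pivot_pos lam wt m \<omega>) = i}"

end

theory Submission
  imports Defs "HOL-Real_Asymp.Real_Asymp"
begin

text \<open>Conditioning on the ideal point x of representative i, the pivot probability of i is
  the integral of f_i(x) H_i(x), where H_i(x) is the probability that the weight S to the left of x,
  without i, lies in the window (q - w_i, q]. Far from the common median, Hoeffding's inequality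
  makes H_i(x) exponentially small. Near it, no local limit theorem is needed: exchanging one
  representative of type t from the right of x to its left gives
  p E[(n - B) h(S + w_t)] = (1 - p) E[B h(S)], where B counts the n members of type t left of x
  and p is close to 1/2. As B/n concentrates at p, the law of S is invariant under the shift by w_t
  up to a factor close to 1 and an exponentially small error. Covering k windows of length w_i by
  l windows of length w_j with k w_i \<le> l w_j then bounds k H_i by about l H_j, and l/k may be taken
  close to w_i/w_j. Since the pivot probabilities sum to 1, the same comparison shows that they
  are at least of order 1/m, so the exponential errors do not matter.\<close>

section \<open>Weighted sums of independent Bernoulli variables\<close>

text \<open>The weights may be incommensurable, so the law of S need not live on a lattice; this is
  why windows are compared through rational approximations of the weight ratio. The comparison
  yields an upper bound only, K times the probability of j plus an error, with K strictly above the
  limit ratio. The matching lower bound is the same upper bound with i and j exchanged. The numbers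
  of windows, the tolerance around 1/2 and the neighbourhood of the median are all fixed by K before
  m grows, so no rate in m is tracked except the exponential one. Since the lower bound of order 1/m
  sums over all representatives up to m, the constants of the comparison must depend on the two
  types only and not on the pair i, j.\<close>

definition wsum :: "('i \<Rightarrow> real) \<Rightarrow> ('i \<Rightarrow> 'a \<Rightarrow> real) \<Rightarrow> 'i set \<Rightarrow> 'a \<Rightarrow> real" where
  "wsum wt X A \<omega> = (\<Sum>l\<in>A. wt l * X l \<omega>)"

lemma wsum_remove:
  assumes "finite D" "l \<in> D"
  shows "wsum wt X D \<omega> = wsum wt X (D - {l}) \<omega> + wt l * X l \<omega>"
  using assms by (simp add: wsum_def sum.remove)

locale bernoulli_family = prob_space M for M :: "'a measure" +
  fixes D :: "'i set" and X :: "'i \<Rightarrow> 'a \<Rightarrow> real" and wt :: "'i \<Rightarrow> real"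
  assumes fin: "finite D"
    and indep: "indep_vars (\<lambda>_. borel) X D"
    and X01: "\<And>l \<omega>. l \<in> D \<Longrightarrow> X l \<omega> \<in> {0, 1}"
begin

lemma X_measurable [measurable]: "l \<in> D \<Longrightarrow> X l \<in> borel_measurable M"
  using indep by (auto simp: indep_vars_def)

lemma wsum_measurable [measurable]: "A \<subseteq> D \<Longrightarrow> wsum wt X A \<in> borel_measurable M"
  unfolding wsum_def by (intro borel_measurable_sum borel_measurable_times) auto

lemma subfamily: "A \<subseteq> D \<Longrightarrow> bernoulli_family M A X"
  by unfold_locales (use fin finite_subset indep_vars_subset[OF indep] X01 in blast)+

lemma indep_wsum_remove:
  assumes "l \<in> D"
  shows "indep_var borel (X l) borel (wsum wt X (D - {l}))"
proof -
  have "indep_var borel ((\<lambda>f. f l) \<circ> (\<lambda>\<omega>. restrict (\<lambda>i. X i \<omega>) {l}))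
          borel ((\<lambda>f. \<Sum>i\<in>D - {l}. wt i * f i) \<circ> (\<lambda>\<omega>. restrict (\<lambda>i. X i \<omega>) (D - {l})))"
    using assms by (intro indep_var_compose[OF indep_var_restrict[OF indep]]) auto
  also have "(\<lambda>f. f l) \<circ> (\<lambda>\<omega>. restrict (\<lambda>i. X i \<omega>) {l}) = X l"
    by auto
  also have "(\<lambda>f. \<Sum>i\<in>D - {l}. wt i * f i) \<circ> (\<lambda>\<omega>. restrict (\<lambda>i. X i \<omega>) (D - {l}))
             = wsum wt X (D - {l})"
    by (auto cong: rev_conj_cong simp: fun_eq_iff wsum_def)
  finally show ?thesis .
qed

lemma expectation_X_times:
  fixes g :: "real \<Rightarrow> real"
  assumes l: "l \<in> D" and g [measurable]: "g \<in> borel_measurable borel" and b: "\<And>y. \<bar>g y\<bar> \<le> 1"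
  shows "expectation (\<lambda>\<omega>. X l \<omega> * g (wsum wt X (D - {l}) \<omega>)) =
           expectation (X l) * expectation (\<lambda>\<omega>. g (wsum wt X (D - {l}) \<omega>))" (is ?A)
    and "expectation (\<lambda>\<omega>. (1 - X l \<omega>) * g (wsum wt X (D - {l}) \<omega>)) =
           (1 - expectation (X l)) * expectation (\<lambda>\<omega>. g (wsum wt X (D - {l}) \<omega>))" (is ?B)
proof -
  have [measurable]: "wsum wt X (D - {l}) \<in> borel_measurable M"
    by (rule wsum_measurable) auto
  note [measurable] = X_measurable[OF l]
  have ig: "integrable M (\<lambda>\<omega>. g (wsum wt X (D - {l}) \<omega>))"
    by (rule integrable_const_bound[of _ 1]) (use b in auto)
  have iX: "integrable M (X l)"
  proof (rule integrable_const_bound[of _ 1])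
    have "norm (X l \<omega>) \<le> 1" for \<omega> using X01[OF l, of \<omega>] by auto
    then show "AE \<omega> in M. norm (X l \<omega>) \<le> 1" by simp
  qed simp
  have ind: "indep_var borel (X l) borel (\<lambda>\<omega>. g (wsum wt X (D - {l}) \<omega>))"
    using indep_var_compose[OF indep_wsum_remove[OF l] measurable_ident g] by (simp add: comp_def)
  show 1: ?A
    using indep_var_lebesgue_integral[OF ind iX ig] by simp
  have "integrable M (\<lambda>\<omega>. X l \<omega> * g (wsum wt X (D - {l}) \<omega>))"
    using indep_var_integrable[OF ind iX ig] .
  then show ?B
    using 1 ig by (simp add: left_diff_distrib)
qed

text \<open>Conditions on the value of \<open>X l\<close>. It serves to put a single variable back
  into a sum from which it was removed.\<close>

lemma expectation_split:
  fixes g :: "real \<Rightarrow> real"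
  assumes l: "l \<in> D" and g [measurable]: "g \<in> borel_measurable borel" and b: "\<And>y. \<bar>g y\<bar> \<le> 1"
  shows "expectation (\<lambda>\<omega>. g (wsum wt X D \<omega>)) =
    (1 - expectation (X l)) * expectation (\<lambda>\<omega>. g (wsum wt X (D - {l}) \<omega>)) +
    expectation (X l) * expectation (\<lambda>\<omega>. g (wsum wt X (D - {l}) \<omega> + wt l))"
proof -
  have [measurable]: "wsum wt X (D - {l}) \<in> borel_measurable M"
    by (rule wsum_measurable) auto
  note [measurable] = X_measurable[OF l]
  have bd: "\<bar>X l \<omega> * z\<bar> \<le> 1" "\<bar>(1 - X l \<omega>) * z\<bar> \<le> 1" if "\<bar>z\<bar> \<le> 1" for z :: real and \<omega>
    using X01[OF l, of \<omega>] that by auto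
  have "g (wsum wt X D \<omega>) = (1 - X l \<omega>) * g (wsum wt X (D - {l}) \<omega>) +
          X l \<omega> * g (wsum wt X (D - {l}) \<omega> + wt l)" for \<omega>
    using X01[OF l, of \<omega>] by (auto simp: wsum_remove[OF fin l])
  then have "expectation (\<lambda>\<omega>. g (wsum wt X D \<omega>)) =
      expectation (\<lambda>\<omega>. (1 - X l \<omega>) * g (wsum wt X (D - {l}) \<omega>)) +
      expectation (\<lambda>\<omega>. X l \<omega> * g (wsum wt X (D - {l}) \<omega> + wt l))"
    by (simp, intro Bochner_Integration.integral_add)
       (rule integrable_const_bound[of _ 1], use bd b in \<open>auto\<close>)+
  also have "expectation (\<lambda>\<omega>. X l \<omega> * g (wsum wt X (D - {l}) \<omega> + wt l)) =
     expectation (X l) * expectation (\<lambda>\<omega>. g (wsum wt X (D - {l}) \<omega> + wt l))"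
    by (rule expectation_X_times(1)[OF l, of "\<lambda>y. g (y + wt l)"]) (use b in auto)
  finally show ?thesis
    by (simp add: expectation_X_times(2)[OF l g b])
qed

section \<open>The exchange identity and concentration\<close>

text \<open>With p the expectation of \<open>X l\<close> and S' the sum without \<open>l\<close>,
  both sides equal p (1 - p) times the expectation of \<open>g\<close> at S' + \<open>wt l\<close>:
  the shifted sum on \<open>X l = 0\<close> and the plain sum on \<open>X l = 1\<close> take this
  same value.\<close>

lemma swap_one:
  fixes g :: "real \<Rightarrow> real"
  assumes l: "l \<in> D" and g [measurable]: "g \<in> borel_measurable borel" and b: "\<And>y. \<bar>g y\<bar> \<le> 1"
  shows "expectation (X l) * expectation (\<lambda>\<omega>. (1 - X l \<omega>) * g (wsum wt X D \<omega> + wt l)) =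
     (1 - expectation (X l)) * expectation (\<lambda>\<omega>. X l \<omega> * g (wsum wt X D \<omega>))"
proof -
  have eq: "(1 - X l \<omega>) * g (wsum wt X D \<omega> + wt l) =
          (1 - X l \<omega>) * g (wsum wt X (D - {l}) \<omega> + wt l)"
       "X l \<omega> * g (wsum wt X D \<omega>) = X l \<omega> * g (wsum wt X (D - {l}) \<omega> + wt l)" for \<omega>
    using X01[OF l, of \<omega>] by (auto simp: wsum_remove[OF fin l])
  show ?thesis
    unfolding eq using expectation_X_times[OF l, of "\<lambda>y. g (y + wt l)"] b by simp
qed

text \<open>Because all members of \<open>T\<close> share the weight and the success probability,
  the single exchanges add up and the 0/1 factors turn into the count of ones in \<open>T\<close>,
  which concentrates.\<close>

lemma swap_sum:
  fixes g :: "real \<Rightarrow> real"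
  assumes T: "T \<subseteq> D" "\<And>l. l \<in> T \<Longrightarrow> wt l = a" "\<And>l. l \<in> T \<Longrightarrow> expectation (X l) = p"
    and g [measurable]: "g \<in> borel_measurable borel" and b: "\<And>y. \<bar>g y\<bar> \<le> 1"
  shows "p * expectation (\<lambda>\<omega>. (card T - (\<Sum>l\<in>T. X l \<omega>)) * g (wsum wt X D \<omega> + a)) =
     (1 - p) * expectation (\<lambda>\<omega>. (\<Sum>l\<in>T. X l \<omega>) * g (wsum wt X D \<omega>))"
proof -
  have [measurable]: "wsum wt X D \<in> borel_measurable M"
    by (rule wsum_measurable) auto
  have [measurable]: "X l \<in> borel_measurable M" if "l \<in> T" for l
    using T that by auto
  have finT: "finite T" using T fin finite_subset by blast
  have bd: "\<bar>X l \<omega> * z\<bar> \<le> 1" "\<bar>(1 - X l \<omega>) * z\<bar> \<le> 1" if "\<bar>z\<bar> \<le> 1" "l \<in> T" for z :: real and \<omega> l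
    using X01[OF subsetD[OF T(1) that(2)], of \<omega>] that(1) by auto
  have "expectation (\<lambda>\<omega>. (card T - (\<Sum>l\<in>T. X l \<omega>)) * g (wsum wt X D \<omega> + a)) =
     expectation (\<lambda>\<omega>. (\<Sum>l\<in>T. (1 - X l \<omega>) * g (wsum wt X D \<omega> + a)))"
    by (simp add: sum_distrib_right[symmetric] sum_subtractf)
  also have "\<dots> = (\<Sum>l\<in>T. expectation (\<lambda>\<omega>. (1 - X l \<omega>) * g (wsum wt X D \<omega> + a)))"
    by (rule Bochner_Integration.integral_sum, rule integrable_const_bound[of _ 1]) (use bd b in auto)
  also have "p * \<dots> = (\<Sum>l\<in>T. (1 - p) * expectation (\<lambda>\<omega>. X l \<omega> * g (wsum wt X D \<omega>)))"
    unfolding sum_distrib_left 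
  proof (rule sum.cong)
    fix l assume l: "l \<in> T"
    show "p * expectation (\<lambda>\<omega>. (1 - X l \<omega>) * g (wsum wt X D \<omega> + a)) =
          (1 - p) * expectation (\<lambda>\<omega>. X l \<omega> * g (wsum wt X D \<omega>))"
      using swap_one[OF subsetD[OF T(1) l] g b] T(2,3)[OF l] by simp
  qed simp
  also have "\<dots> = (1 - p) * expectation (\<lambda>\<omega>. \<Sum>l\<in>T. X l \<omega> * g (wsum wt X D \<omega>))"
    unfolding sum_distrib_left[symmetric]
    by (rule arg_cong[where f="(*) _"], rule Bochner_Integration.integral_sum[symmetric],
        rule integrable_const_bound[of _ 1]) (use bd b in auto)
  finally show ?thesis by (simp add: sum_distrib_right)
qed

text \<open>Hoeffding's inequality for summands in [0, \<open>W\<close>]. The coefficients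
  \<open>v\<close> are kept apart from \<open>wt\<close> because the bound is used for the plain
  count of ones, with \<open>v\<close> constant 1, as well as for the weighted sum.\<close>

lemma tail_weighted:
  fixes v :: "'i \<Rightarrow> real" and W :: real
  assumes T: "T \<subseteq> D" "T \<noteq> {}" and W: "W > 0" "\<And>l. l \<in> T \<Longrightarrow> 0 \<le> v l \<and> v l \<le> W"
    and \<epsilon>: "\<epsilon> \<ge> 0"
  shows "prob {\<omega>\<in>space M. \<bar>wsum v X T \<omega> - (\<Sum>l\<in>T. v l * expectation (X l))\<bar> \<ge> \<epsilon>}
           \<le> 2 * exp (-2 * \<epsilon>\<^sup>2 / (card T * W\<^sup>2))"
proof -
  have finT: "finite T" using T fin finite_subset by blast
  have ind: "indep_vars (\<lambda>_. borel) (\<lambda>l \<omega>. v l * X l \<omega>) T"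
    by (rule indep_vars_compose2[OF indep_vars_subset[OF indep T(1)]]) auto
  interpret Hoeffding_ineq M T "\<lambda>l \<omega>. v l * X l \<omega>" "\<lambda>_. 0" "\<lambda>_. W" "\<Sum>l\<in>T. v l * expectation (X l)"
  proof unfold_locales
    fix l assume l: "l \<in> T"
    show "AE \<omega> in M. v l * X l \<omega> \<in> {0..W}"
    proof (rule AE_I2)
      fix \<omega> show "v l * X l \<omega> \<in> {0..W}"
        using X01[OF subsetD[OF T(1) l], of \<omega>] W(2)[OF l] W(1) by auto
    qed
  qed (use finT ind in auto)
  have "(\<Sum>i\<in>T. (W - 0)\<^sup>2) > 0" using T W finT by (simp add: card_gt_0_iff)
  from Hoeffding_ineq_abs_ge[OF \<epsilon> this] show ?thesis
    by (simp add: wsum_def)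
qed

section \<open>Near invariance under a shift by one weight\<close>

text \<open>Replaces the random factor \<open>B\<close> by the constant 1/2. Where \<open>B\<close>
  is within \<delta> of 1/2 the bound is pointwise; elsewhere the integrands are at most 1, so the
  probability \<open>t\<close> of that event pays for it.\<close>

lemma expectation_near_indicator:
  fixes g B :: "'a \<Rightarrow> real"
  assumes [measurable]: "g \<in> borel_measurable M" "B \<in> borel_measurable M"
    and g: "\<And>\<omega>. 0 \<le> g \<omega> \<and> g \<omega> \<le> 1" and B: "\<And>\<omega>. 0 \<le> B \<omega> \<and> B \<omega> \<le> 1"
    and t: "prob {\<omega>\<in>space M. \<bar>B \<omega> - 1/2\<bar> \<ge> \<delta>} \<le> t" and \<delta>: "0 \<le> \<delta>" "\<delta> \<le> 1/2"
  shows "expectation (\<lambda>\<omega>. B \<omega> * g \<omega>) \<le> (1/2 + \<delta>) * expectation g + t"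
    and "(1/2 - \<delta>) * expectation g \<le> expectation (\<lambda>\<omega>. B \<omega> * g \<omega>) + t"
proof -
  let ?b = "\<lambda>\<omega>. indicator {\<omega>\<in>space M. \<bar>B \<omega> - 1/2\<bar> \<ge> \<delta>} \<omega> :: real"
  have ib: "integrable M ?b" by (rule integrable_const_bound[of _ 1]) auto
  have ig: "integrable M g" by (rule integrable_const_bound[of _ 1]) (use g in auto)
  have iB: "integrable M (\<lambda>\<omega>. B \<omega> * g \<omega>)"
    by (rule integrable_const_bound[of _ 1]) (use g B in \<open>auto simp: abs_mult intro!: AE_I2 mult_le_one\<close>)
  have eb: "expectation ?b \<le> t" using t by simp
  have "expectation (\<lambda>\<omega>. B \<omega> * g \<omega>) \<le> expectation (\<lambda>\<omega>. (1/2 + \<delta>) * g \<omega> + ?b \<omega>)"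
  proof (rule integral_mono)
    fix \<omega> assume \<omega>: "\<omega> \<in> space M"
    show "B \<omega> * g \<omega> \<le> (1/2 + \<delta>) * g \<omega> + ?b \<omega>"
    proof (cases "\<bar>B \<omega> - 1/2\<bar> \<ge> \<delta>")
      case True
      have "B \<omega> * g \<omega> \<le> 1" using B[of \<omega>] g[of \<omega>] by (simp add: mult_le_one)
      moreover have "0 \<le> (1/2 + \<delta>) * g \<omega>" using g \<delta> by simp
      ultimately show ?thesis using True \<omega> by simp
    next
      case False
      then have "B \<omega> \<le> 1/2 + \<delta>" by (auto simp: abs_le_iff)
      then show ?thesis using g by (simp add: mult_right_mono add_increasing2)
    qed
  qed (use ib ig iB in auto)
  also have "\<dots> = (1/2 + \<delta>) * expectation g + expectation ?b"
    using ib ig by simp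
  finally show "expectation (\<lambda>\<omega>. B \<omega> * g \<omega>) \<le> (1/2 + \<delta>) * expectation g + t"
    using eb by linarith
  have "(1/2 - \<delta>) * expectation g = expectation (\<lambda>\<omega>. (1/2 - \<delta>) * g \<omega>)" by simp
  also have "\<dots> \<le> expectation (\<lambda>\<omega>. B \<omega> * g \<omega> + ?b \<omega>)"
  proof (rule integral_mono)
    fix \<omega> assume \<omega>: "\<omega> \<in> space M"
    show "(1/2 - \<delta>) * g \<omega> \<le> B \<omega> * g \<omega> + ?b \<omega>"
    proof (cases "\<bar>B \<omega> - 1/2\<bar> \<ge> \<delta>")
      case True
      have "(1/2 - \<delta>) * g \<omega> \<le> 1" using \<delta> g[of \<omega>] by (simp add: mult_le_one)
      moreover have "0 \<le> B \<omega> * g \<omega>" using g B by simp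
      ultimately show ?thesis using True \<omega> by simp
    next
      case False
      then have "1/2 - \<delta> \<le> B \<omega>" by (auto simp: abs_le_iff)
      then show ?thesis using g by (simp add: mult_right_mono add_increasing2)
    qed
  qed (use ib ig iB in auto)
  also have "\<dots> = expectation (\<lambda>\<omega>. B \<omega> * g \<omega>) + expectation ?b"
    using ib iB by simp
  finally show "(1/2 - \<delta>) * expectation g \<le> expectation (\<lambda>\<omega>. B \<omega> * g \<omega>) + t"
    using eb by linarith
qed

text \<open>With B the fraction of ones in \<open>T\<close>, the exchange identity reads p
  E[(1 - B) h(S + a)] = (1 - p) E[B h(S)]. Of the two factors in \<kappa>, one pays for p against 1
  - p and the other for B against 1 - B.\<close>

lemma shift_near:
  fixes h :: "real \<Rightarrow> real"
  assumes T: "T \<subseteq> D" "T \<noteq> {}" "\<And>l. l \<in> T \<Longrightarrow> wt l = a" "\<And>l. l \<in> T \<Longrightarrow> expectation (X l) = p"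
    and h [measurable]: "h \<in> borel_measurable borel" and h01: "\<And>y. 0 \<le> h y \<and> h y \<le> 1"
    and \<delta>: "0 < \<delta>" "\<delta> \<le> 1/16" and p: "\<bar>p - 1/2\<bar> \<le> \<delta>"
  defines "\<kappa> \<equiv> ((1/2 + 2 * \<delta>) / (1/2 - 2 * \<delta>))\<^sup>2"
  defines "t \<equiv> 2 * exp (-2 * \<delta>\<^sup>2 * card T)"
  shows "expectation (\<lambda>\<omega>. h (wsum wt X D \<omega> + a)) \<le> \<kappa> * expectation (\<lambda>\<omega>. h (wsum wt X D \<omega>)) + 8 * t"
    and "expectation (\<lambda>\<omega>. h (wsum wt X D \<omega>)) \<le> \<kappa> * expectation (\<lambda>\<omega>. h (wsum wt X D \<omega> + a)) + 8 * t"
proof -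
  have [measurable]: "wsum wt X D \<in> borel_measurable M"
    by (rule wsum_measurable) auto
  have [measurable]: "X l \<in> borel_measurable M" if "l \<in> T" for l
    using T that by auto
  have finT: "finite T" using T fin finite_subset by blast
  define n where "n = real (card T)"
  have n: "n > 0" using finT T by (simp add: n_def card_gt_0_iff)
  define B where "B \<omega> = (\<Sum>l\<in>T. X l \<omega>) / n" for \<omega>
  have B_meas [measurable]: "B \<in> borel_measurable M" unfolding B_def by measurable
  have X01': "0 \<le> X l \<omega> \<and> X l \<omega> \<le> 1" if "l \<in> T" for l \<omega>
    using X01[OF subsetD[OF T(1) that], of \<omega>] by auto
  have B01: "0 \<le> B \<omega> \<and> B \<omega> \<le> 1" for \<omega>
    using sum_nonneg[of T "\<lambda>l. X l \<omega>"] sum_mono[of T "\<lambda>l. X l \<omega>" "\<lambda>_. 1"] X01' n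
    by (auto simp: B_def n_def field_simps)
  \<comment> \<open>Of the tolerance 2\<delta>, one \<delta> covers the distance of \<open>p\<close>
    from 1/2; the other is the deviation of \<open>B\<close> from \<open>p\<close> that Hoeffding's
    inequality controls.\<close>
  have "{\<omega>\<in>space M. \<bar>B \<omega> - 1/2\<bar> \<ge> 2 * \<delta>}
      \<subseteq> {\<omega>\<in>space M. \<bar>wsum (\<lambda>_. 1) X T \<omega> - (\<Sum>l\<in>T. 1 * expectation (X l))\<bar> \<ge> \<delta> * n}"
  proof safe
    fix \<omega> assume "\<bar>B \<omega> - 1/2\<bar> \<ge> 2 * \<delta>"
    then have "\<delta> \<le> \<bar>B \<omega> - p\<bar>" using p by linarith
    then have "\<delta> * n \<le> \<bar>B \<omega> - p\<bar> * n" using n by simp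
    also have "\<dots> = \<bar>B \<omega> * n - p * n\<bar>"
      using n by (simp add: abs_mult left_diff_distrib[symmetric])
    also have "B \<omega> * n - p * n = wsum (\<lambda>_. 1) X T \<omega> - (\<Sum>l\<in>T. 1 * expectation (X l))"
      using n T(4) by (simp add: B_def wsum_def) (simp add: n_def)
    finally show "\<delta> * n \<le> \<bar>wsum (\<lambda>_. 1) X T \<omega> - (\<Sum>l\<in>T. 1 * expectation (X l))\<bar>" .
  qed
  then have "prob {\<omega>\<in>space M. \<bar>B \<omega> - 1/2\<bar> \<ge> 2 * \<delta>}
      \<le> prob {\<omega>\<in>space M. \<bar>wsum (\<lambda>_. 1) X T \<omega> - (\<Sum>l\<in>T. 1 * expectation (X l))\<bar> \<ge> \<delta> * n}"
    by (rule finite_measure_mono) (unfold wsum_def, measurable)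
  also have "\<dots> \<le> 2 * exp (-2 * (\<delta> * n)\<^sup>2 / (real (card T) * (1::real)\<^sup>2))"
    by (rule tail_weighted) (use T \<delta> n in auto)
  also have "\<dots> = t"
    using n by (simp add: t_def n_def power2_eq_square)
  finally have t: "prob {\<omega>\<in>space M. \<bar>B \<omega> - 1/2\<bar> \<ge> 2 * \<delta>} \<le> t" .
  then have t': "prob {\<omega>\<in>space M. \<bar>(1 - B \<omega>) - 1/2\<bar> \<ge> 2 * \<delta>} \<le> t"
    by (simp add: abs_minus_commute)
  define u v where "u = expectation (\<lambda>\<omega>. h (wsum wt X D \<omega> + a))"
    and "v = expectation (\<lambda>\<omega>. h (wsum wt X D \<omega>))"
  define u' v' where "u' = expectation (\<lambda>\<omega>. (1 - B \<omega>) * h (wsum wt X D \<omega> + a))"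
    and "v' = expectation (\<lambda>\<omega>. B \<omega> * h (wsum wt X D \<omega>))"
  have swap: "p * u' = (1 - p) * v'"
  proof -
    have hb: "\<bar>h y\<bar> \<le> 1" for y using h01[of y] by simp
    have "n * u' = expectation (\<lambda>\<omega>. (card T - (\<Sum>l\<in>T. X l \<omega>)) * h (wsum wt X D \<omega> + a))"
      unfolding u'_def integral_mult_right_zero[symmetric] using n
      by (intro Bochner_Integration.integral_cong) (auto simp: B_def n_def[symmetric] field_simps)
    moreover have "n * v' = expectation (\<lambda>\<omega>. (\<Sum>l\<in>T. X l \<omega>) * h (wsum wt X D \<omega>))"
      unfolding v'_def integral_mult_right_zero[symmetric] using n
      by (intro Bochner_Integration.integral_cong) (auto simp: B_def)
    ultimately have "p * (n * u') = (1 - p) * (n * v')"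
      using swap_sum[OF T(1) T(3) T(4) h hb] by simp
    then show ?thesis using n by simp
  qed
  have u: "u' \<le> (1/2 + 2*\<delta>) * u + t" "(1/2 - 2*\<delta>) * u \<le> u' + t"
    unfolding u_def u'_def
    using expectation_near_indicator[of "\<lambda>\<omega>. h (wsum wt X D \<omega> + a)" "\<lambda>\<omega>. 1 - B \<omega>" "2*\<delta>" t] h01 B01 t' \<delta>
    by auto
  have v: "v' \<le> (1/2 + 2*\<delta>) * v + t" "(1/2 - 2*\<delta>) * v \<le> v' + t"
    unfolding v_def v'_def
    using expectation_near_indicator[of "\<lambda>\<omega>. h (wsum wt X D \<omega>)" B "2*\<delta>" t] h01 B01 t \<delta>
    by auto
  have u0: "0 \<le> u" "0 \<le> v" unfolding u_def v_def using h01 by (auto intro: integral_nonneg)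
  have t0: "0 \<le> t" unfolding t_def by simp
  \<comment> \<open>Stated for an abstract \<open>s\<close>: the second claim is the same estimate
    with \<open>1 - p\<close> for \<open>p\<close> and the roles of \<open>B\<close> and
    \<open>1 - B\<close> exchanged.\<close>
  have key: "x \<le> \<kappa> * y + 8 * t"
    if "(1/2 - 2*\<delta>) * x \<le> x' + t" "y' \<le> (1/2 + 2*\<delta>) * y + t" "s * x' = (1 - s) * y'"
      "0 \<le> x" "0 \<le> y" "\<bar>s - 1/2\<bar> \<le> \<delta>" for x y x' y' s
  proof -
    define A C where "A = 1/2 - 2*\<delta>" and "C = 1/2 + 2*\<delta>"
    have s: "A \<le> s" "1 - s \<le> C" "0 < s" "s < 1" and A: "3/8 \<le> A" "0 \<le> C"
      using that(6) \<delta> by (auto simp: A_def C_def abs_le_iff)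
    have "A * (A * x) \<le> s * (A * x)" using s A that by (intro mult_right_mono) auto
    also have "\<dots> \<le> s * (x' + t)" using that s by (intro mult_left_mono) (auto simp: A_def)
    also have "\<dots> = (1 - s) * y' + s * t" using that(3) by (simp add: algebra_simps)
    also have "(1 - s) * y' \<le> (1 - s) * (C * y + t)"
      using that s by (intro mult_left_mono) (auto simp: C_def)
    also have "\<dots> \<le> C * (C * y) + (1 - s) * t"
      using s A that by (simp add: distrib_left mult_right_mono)
    finally have *: "A\<^sup>2 * x \<le> C\<^sup>2 * y + t" by (simp add: algebra_simps power2_eq_square)
    \<comment> \<open>Origin of the factor 8 in the error: \<delta> \<le> 1/16 gives A \<ge> 3/8, so
      dividing the error \<open>t\<close> by the square of A costs at most 8.\<close>
    have A2: "1/8 \<le> A\<^sup>2" using power_mono[of "3/8" A 2] A by (simp add: power2_eq_square)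
    have "A\<^sup>2 * x \<le> A\<^sup>2 * (\<kappa> * y + 8 * t)"
    proof -
      have "A\<^sup>2 * (\<kappa> * y) = C\<^sup>2 * y"
        using A by (simp add: \<kappa>_def A_def[symmetric] C_def[symmetric] power_divide)
      moreover have "t \<le> A\<^sup>2 * (8 * t)" using mult_right_mono[OF A2, of "8*t"] t0 by simp
      ultimately show ?thesis using * unfolding distrib_left by linarith
    qed
    then show ?thesis using A by (simp add: mult_le_cancel_left)
  qed
  show "u \<le> \<kappa> * v + 8 * t"
    by (rule key[OF u(2) v(1) swap]) (use u0 p in auto)
  show "v \<le> \<kappa> * u + 8 * t"
    by (rule key[OF v(2) u(1), of "1 - p"]) (use u0 p swap in auto)
qed

end

context bernoulli_family begin

text \<open>Quantifying over all test functions with values in [0, 1] makes the property iterable,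
  since a translate of a test function is again one. Both directions are required because the window
  comparison moves windows both ways.\<close>

definition nearly_shift_invariant :: "real \<Rightarrow> real \<Rightarrow> real \<Rightarrow> bool" where
  "nearly_shift_invariant \<kappa> t a \<longleftrightarrow>
    (\<forall>h \<in> borel_measurable borel. (\<forall>y. 0 \<le> h y \<and> h y \<le> 1) \<longrightarrow>
      expectation (\<lambda>\<omega>. h (wsum wt X D \<omega> + a)) \<le> \<kappa> * expectation (\<lambda>\<omega>. h (wsum wt X D \<omega>)) + t \<and>
      expectation (\<lambda>\<omega>. h (wsum wt X D \<omega>)) \<le> \<kappa> * expectation (\<lambda>\<omega>. h (wsum wt X D \<omega> + a)) + t)"

lemma shift_invariantD:
  fixes h :: "real \<Rightarrow> real"
  assumes "nearly_shift_invariant \<kappa> t a" "h \<in> borel_measurable borel" "\<And>y. 0 \<le> h y \<and> h y \<le> 1"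
  shows "expectation (\<lambda>\<omega>. h (wsum wt X D \<omega> + a)) \<le> \<kappa> * expectation (\<lambda>\<omega>. h (wsum wt X D \<omega>)) + t"
    and "expectation (\<lambda>\<omega>. h (wsum wt X D \<omega>)) \<le> \<kappa> * expectation (\<lambda>\<omega>. h (wsum wt X D \<omega> + a)) + t"
  using assms unfolding nearly_shift_invariant_def by blast+

text \<open>Each step applies the one-step bound to a translate of \<open>h\<close>. Multiplying
  every accumulated error by the full power of \<kappa> is crude, but \<open>s\<close> will stay
  bounded while m grows.\<close>

lemma iterated_shift:
  fixes h :: "real \<Rightarrow> real" and s :: nat and a t \<kappa> :: real
  assumes sh: "nearly_shift_invariant \<kappa> t a" and \<kappa>: "\<kappa> \<ge> 1" and t: "t \<ge> 0"
    and h [measurable]: "h \<in> borel_measurable borel" and h01: "\<And>y. 0 \<le> h y \<and> h y \<le> 1"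
  shows "expectation (\<lambda>\<omega>. h (wsum wt X D \<omega> + s * a))
           \<le> \<kappa> ^ s * (expectation (\<lambda>\<omega>. h (wsum wt X D \<omega>)) + s * t)"
    and "expectation (\<lambda>\<omega>. h (wsum wt X D \<omega>))
           \<le> \<kappa> ^ s * (expectation (\<lambda>\<omega>. h (wsum wt X D \<omega> + s * a)) + s * t)"
proof (induction s)
  case 0
  show "expectation (\<lambda>\<omega>. h (wsum wt X D \<omega> + real 0 * a))
           \<le> \<kappa> ^ 0 * (expectation (\<lambda>\<omega>. h (wsum wt X D \<omega>)) + real 0 * t)"
    and "expectation (\<lambda>\<omega>. h (wsum wt X D \<omega>))
           \<le> \<kappa> ^ 0 * (expectation (\<lambda>\<omega>. h (wsum wt X D \<omega> + real 0 * a)) + real 0 * t)"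
    by simp_all
next
  case (Suc s)
  let ?e = "\<lambda>s. expectation (\<lambda>\<omega>. h (wsum wt X D \<omega> + real s * a))"
  have shift: "?e (Suc s) \<le> \<kappa> * ?e s + t" "?e s \<le> \<kappa> * ?e (Suc s) + t"
    using shift_invariantD[OF sh, of "\<lambda>y. h (y + real s * a)"] h01 by (simp_all add: algebra_simps)
  have \<kappa>s: "\<kappa> ^ s \<ge> 1" "\<kappa> * \<kappa> ^ s \<ge> 1" using one_le_power[OF \<kappa>, of s] one_le_power[OF \<kappa>, of "Suc s"] by auto
  have "?e (Suc s) \<le> \<kappa> * (\<kappa> ^ s * (expectation (\<lambda>\<omega>. h (wsum wt X D \<omega>)) + s * t)) + 1 * t"
  proof -
    have "\<kappa> * ?e s \<le> \<kappa> * (\<kappa> ^ s * (expectation (\<lambda>\<omega>. h (wsum wt X D \<omega>)) + s * t))"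
      by (rule mult_left_mono[OF Suc(1)]) (use \<kappa> in auto)
    then show ?thesis using shift(1) by linarith
  qed
  also have "\<dots> \<le> \<kappa> * (\<kappa> ^ s * (expectation (\<lambda>\<omega>. h (wsum wt X D \<omega>)) + s * t)) + (\<kappa> * \<kappa> ^ s) * t"
    using \<kappa>s t by (intro add_left_mono mult_right_mono) auto
  finally show "?e (Suc s) \<le> \<kappa> ^ Suc s * (expectation (\<lambda>\<omega>. h (wsum wt X D \<omega>)) + real (Suc s) * t)"
    by (simp add: algebra_simps)
  have "expectation (\<lambda>\<omega>. h (wsum wt X D \<omega>)) \<le> \<kappa> ^ s * (?e s + s * t)" by (rule Suc)
  also have "\<dots> \<le> \<kappa> ^ s * ((\<kappa> * ?e (Suc s) + 1 * t) + 1 * (s * t))"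
    using shift(2) \<kappa>s by (intro mult_left_mono add_mono) auto
  also have "\<dots> \<le> \<kappa> ^ s * ((\<kappa> * ?e (Suc s) + \<kappa> * t) + \<kappa> * (s * t))"
    using \<kappa> \<kappa>s t by (intro mult_left_mono add_mono mult_right_mono) auto
  finally show "expectation (\<lambda>\<omega>. h (wsum wt X D \<omega>)) \<le> \<kappa> ^ Suc s * (?e (Suc s) + real (Suc s) * t)"
    by (simp add: algebra_simps)
qed

section \<open>Tiling and comparing windows\<close>

text \<open>The translates are the adjacent pieces (q - (s+1)a, q - sa]. Being half-open, they tile
  the long window with neither gap nor overlap, so there is an equality of indicators.\<close>

lemma sum_indicator_translates:
  fixes a q y :: real
  assumes "a > 0"
  shows "(\<Sum>s<k. indicator {q - a<..q} (y + real s * a)) = (indicator {q - real k * a<..q} y :: real)"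
proof (induction k)
  case (Suc k)
  obtain c where c: "real k * a = c" "0 \<le> c" using assms by simp
  then have "real (Suc k) * a = c + a" by (simp add: algebra_simps)
  then show ?case using Suc assms c by (auto simp: indicator_def)
qed simp

lemma expectation_window_multiple:
  fixes a q :: real and k :: nat
  assumes "a > 0"
  shows "expectation (\<lambda>\<omega>. indicator {q - k * a<..q} (wsum wt X D \<omega>) :: real) =
         (\<Sum>s<k. expectation (\<lambda>\<omega>. indicator {q - a<..q} (wsum wt X D \<omega> + s * a)))"
proof -
  have [measurable]: "wsum wt X D \<in> borel_measurable M"
    by (rule wsum_measurable) auto
  show ?thesis
    unfolding sum_indicator_translates[OF assms, symmetric]
    by (rule Bochner_Integration.integral_sum, rule integrable_const_bound[of _ 1]) auto
qed

text \<open>Each tile is a translate of the basic window, so the tiles of one long window have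
  nearly equal mass. The two long windows share the end point \<open>q\<close>, hence
  \<open>k * a \<le> l * b\<close> makes them nested. The squares arise because k tiles carry an
  error of k \<open>t\<close> each, and l tiles one of l \<open>t\<close>.\<close>

lemma window_compare:
  fixes a b q \<kappa> t :: real and k l :: nat
  assumes sh: "nearly_shift_invariant \<kappa> t a" "nearly_shift_invariant \<kappa> t b"
    and \<kappa>: "\<kappa> \<ge> 1" and t: "t \<ge> 0" and ab: "a > 0" "b > 0" "k * a \<le> l * b"
  shows "k * expectation (\<lambda>\<omega>. indicator {q - a<..q} (wsum wt X D \<omega>) :: real) \<le>
     \<kappa> ^ (k + l) * (l * expectation (\<lambda>\<omega>. indicator {q - b<..q} (wsum wt X D \<omega>) :: real) + (real l ^ 2 + real k ^ 2) * t)"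
proof -
  have [measurable]: "wsum wt X D \<in> borel_measurable M"
    by (rule wsum_measurable) auto
  let ?E = "\<lambda>c. expectation (\<lambda>\<omega>. indicator {q - c<..q} (wsum wt X D \<omega>)) :: real"
  let ?e = "\<lambda>c s. expectation (\<lambda>\<omega>. indicator {q - c<..q} (wsum wt X D \<omega> + real s * c)) :: real"
  have e0: "0 \<le> ?e c s" "0 \<le> ?E c" for c s by (auto intro: Bochner_Integration.integral_nonneg)
  have ind: "(indicator A :: real \<Rightarrow> real) \<in> borel_measurable borel" if "A \<in> sets borel" for A
    using that by measurable
  have "k * ?E a = (\<Sum>s<k. ?E a)" by simp
  also have "\<dots> \<le> (\<Sum>s<k. \<kappa> ^ k * (?e a s + k * t))"
  proof (rule sum_mono)
    fix s assume s: "s \<in> {..<k}"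
    have "?E a \<le> \<kappa> ^ s * (?e a s + s * t)"
      by (rule iterated_shift(2)[OF sh(1) \<kappa> t]) auto
    also have "\<dots> \<le> \<kappa> ^ k * (?e a s + k * t)"
      using s \<kappa> t e0 by (intro mult_mono power_increasing add_mono mult_right_mono) auto
    finally show "?E a \<le> \<kappa> ^ k * (?e a s + k * t)" .
  qed
  also have "\<dots> = \<kappa> ^ k * (?E (k * a) + real k ^ 2 * t)"
    by (simp add: expectation_window_multiple[OF ab(1)] sum_distrib_left[symmetric] sum.distrib power2_eq_square)
  finally have 1: "k * ?E a \<le> \<kappa> ^ k * (?E (k * a) + real k ^ 2 * t)" .
  have "?E (k * a) \<le> ?E (l * b)"
    by (rule integral_mono) (use ab in \<open>auto intro!: integrable_const_bound[of _ 1] simp: indicator_def\<close>)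
  also have "\<dots> = (\<Sum>s<l. ?e b s)"
    by (rule expectation_window_multiple[OF ab(2)])
  also have "\<dots> \<le> (\<Sum>s<l. \<kappa> ^ l * (?E b + l * t))"
  proof (rule sum_mono)
    fix s assume s: "s \<in> {..<l}"
    have "?e b s \<le> \<kappa> ^ s * (?E b + s * t)"
      by (rule iterated_shift(1)[OF sh(2) \<kappa> t]) auto
    also have "\<dots> \<le> \<kappa> ^ l * (?E b + l * t)"
      using s \<kappa> t e0 by (intro mult_mono power_increasing add_mono mult_right_mono) auto
    finally show "?e b s \<le> \<kappa> ^ l * (?E b + l * t)" .
  qed
  also have "\<dots> = \<kappa> ^ l * (l * ?E b + real l ^ 2 * t)"
    by (simp add: power2_eq_square algebra_simps)
  finally have 2: "?E (k * a) \<le> \<kappa> ^ l * (l * ?E b + real l ^ 2 * t)" .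
  have "?E (k * a) + 1 * (real k ^ 2 * t) \<le> \<kappa> ^ l * (l * ?E b + real l ^ 2 * t) + \<kappa> ^ l * (real k ^ 2 * t)"
    using 2 t one_le_power[OF \<kappa>, of l] by (intro add_mono mult_right_mono) auto
  then have "?E (k * a) + real k ^ 2 * t \<le> \<kappa> ^ l * (l * ?E b + (real l ^ 2 + real k ^ 2) * t)"
    by (simp add: algebra_simps)
  from mult_left_mono[OF this, of "\<kappa> ^ k"] \<kappa> show ?thesis
    by (intro order_trans[OF 1]) (simp add: power_add mult.assoc)
qed

text \<open>Replaces the size of \<open>T\<close> by a lower bound \<open>n\<close>, so that the
  shifts by the weights of two different types can share one error term. The factor 16 is 8 times
  the 2 of the two-sided tail bound.\<close>

lemma nearly_shift_invariant_near:
  assumes T: "T \<subseteq> D" "\<And>l. l \<in> T \<Longrightarrow> wt l = a" "\<And>l. l \<in> T \<Longrightarrow> expectation (X l) = p"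
    and n: "0 < n" "n \<le> card T"
    and \<delta>: "0 < \<delta>" "\<delta> \<le> 1/16" and p: "\<bar>p - 1/2\<bar> \<le> \<delta>"
  shows "nearly_shift_invariant (((1/2 + 2 * \<delta>) / (1/2 - 2 * \<delta>))\<^sup>2) (16 * exp (-2 * \<delta>\<^sup>2 * n)) a"
proof -
  have ne: "T \<noteq> {}" using n by auto
  have le: "exp (-2 * \<delta>\<^sup>2 * card T) \<le> exp (-2 * \<delta>\<^sup>2 * n)"
    using n by (simp add: mult_left_mono)
  show ?thesis
    unfolding nearly_shift_invariant_def
  proof (intro ballI impI)
    fix h :: "real \<Rightarrow> real" assume h: "h \<in> borel_measurable borel" "\<forall>y. 0 \<le> h y \<and> h y \<le> 1"
    show "expectation (\<lambda>\<omega>. h (wsum wt X D \<omega> + a)) \<le> ((1/2 + 2 * \<delta>) / (1/2 - 2 * \<delta>))\<^sup>2 *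
        expectation (\<lambda>\<omega>. h (wsum wt X D \<omega>)) + 16 * exp (-2 * \<delta>\<^sup>2 * n) \<and>
      expectation (\<lambda>\<omega>. h (wsum wt X D \<omega>)) \<le> ((1/2 + 2 * \<delta>) / (1/2 - 2 * \<delta>))\<^sup>2 *
        expectation (\<lambda>\<omega>. h (wsum wt X D \<omega> + a)) + 16 * exp (-2 * \<delta>\<^sup>2 * n)"
      using shift_near[OF T(1) ne T(2,3) h(1) spec[OF h(2)] \<delta> p] le by linarith
  qed
qed

end

text \<open>Removing both i and j leaves a common family, compared with the families
  without i and without j by conditioning on the other variable.\<close>

lemma (in bernoulli_family) near_compare:
  fixes k l :: nat and q :: real
  assumes ij: "i \<in> D" "j \<in> D" "i \<noteq> j" and w: "wt i > 0" "wt j > 0" "k * wt i \<le> l * wt j"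
    and Ti: "Ti \<subseteq> D - {i, j}" "\<And>u. u \<in> Ti \<Longrightarrow> wt u = wt i" "\<And>u. u \<in> Ti \<Longrightarrow> expectation (X u) = p"
    and Tj: "Tj \<subseteq> D - {i, j}" "\<And>u. u \<in> Tj \<Longrightarrow> wt u = wt j" "\<And>u. u \<in> Tj \<Longrightarrow> expectation (X u) = p'"
    and n: "0 < n" "n \<le> card Ti" "n \<le> card Tj"
    and \<delta>: "0 < \<delta>" "\<delta> \<le> 1/16" and p: "\<bar>p - 1/2\<bar> \<le> \<delta>" "\<bar>p' - 1/2\<bar> \<le> \<delta>"
  defines "\<kappa> \<equiv> ((1/2 + 2 * \<delta>) / (1/2 - 2 * \<delta>))\<^sup>2"
  shows "k * expectation (\<lambda>\<omega>. indicator {q - wt i<..q} (wsum wt X (D - {i}) \<omega>) :: real) \<le>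
     \<kappa> ^ (k + l + 2) * (l * expectation (\<lambda>\<omega>. indicator {q - wt j<..q} (wsum wt X (D - {j}) \<omega>) :: real)
       + (l + k + real l ^ 2 + real k ^ 2) * (16 * exp (-2 * \<delta>\<^sup>2 * n)))"
proof -
  let ?D = "D - {i, j}"
  interpret R: bernoulli_family M ?D X wt by (rule subfamily) auto
  interpret Ri: bernoulli_family M "D - {i}" X wt by (rule subfamily) auto
  interpret Rj: bernoulli_family M "D - {j}" X wt by (rule subfamily) auto
  have eqD: "D - {i} - {j} = ?D" "D - {j} - {i} = ?D" by auto
  define t where "t = 16 * exp (-2 * \<delta>\<^sup>2 * n)"
  have t: "0 \<le> t" by (simp add: t_def)
  have \<kappa>: "1 \<le> \<kappa>"
    unfolding \<kappa>_def using \<delta> by (intro one_le_power) (simp add: field_simps)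
  have sa: "R.nearly_shift_invariant \<kappa> t (wt i)"
    unfolding \<kappa>_def t_def by (rule R.nearly_shift_invariant_near[OF Ti n(1,2) \<delta> p(1)])
  have sb: "R.nearly_shift_invariant \<kappa> t (wt j)"
    unfolding \<kappa>_def t_def by (rule R.nearly_shift_invariant_near[OF Tj n(1,3) \<delta> p(2)])
  have EX: "0 \<le> expectation (X u)" "expectation (X u) \<le> 1" if "u \<in> D" for u
  proof -
    have b: "0 \<le> X u \<omega>" "X u \<omega> \<le> 1" for \<omega> using X01[OF that, of \<omega>] by auto
    show "0 \<le> expectation (X u)" by (rule Bochner_Integration.integral_nonneg) (use b in auto)
    have "integrable M (X u)" using X_measurable[OF that] b
      by (intro integrable_const_bound[of _ 1]) auto
    then show "expectation (X u) \<le> 1" using b by (intro integral_le_const) auto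
  qed
  have convex: "(1 - s) * x + s * y \<le> z" if "x \<le> z" "y \<le> z" "0 \<le> s" "s \<le> 1" for s x y z :: real
    using convex_bound_le[of x z y "1 - s" s] that by simp
  let ?g = "\<lambda>c y. indicator {q - c<..q} y :: real"
  let ?E = "\<lambda>c. expectation (\<lambda>\<omega>. ?g c (wsum wt X ?D \<omega>))"
  have E0: "0 \<le> expectation (\<lambda>\<omega>. ?g c (f \<omega>))" for c f by (auto intro: Bochner_Integration.integral_nonneg)
  have up: "z \<le> \<kappa> * z + t" if "0 \<le> z" for z
    using mult_right_mono[OF \<kappa> that] t by simp
  \<comment> \<open>Restoring \<open>j\<close> mixes the sum over \<open>?D\<close> with its shift
    by \<open>wt j\<close>; both branches are bounded by the unshifted window probability.\<close>
  have "expectation (\<lambda>\<omega>. ?g (wt i) (wsum wt X (D - {i}) \<omega>)) =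
     (1 - expectation (X j)) * ?E (wt i) +
     expectation (X j) * expectation (\<lambda>\<omega>. ?g (wt i) (wsum wt X ?D \<omega> + wt j))"
    using Ri.expectation_split[of j "?g (wt i)"] ij by (simp add: eqD)
  also have "\<dots> \<le> \<kappa> * ?E (wt i) + t"
    by (intro convex up E0 R.shift_invariantD(1)[OF sb] EX ij) auto
  finally have 1: "expectation (\<lambda>\<omega>. ?g (wt i) (wsum wt X (D - {i}) \<omega>)) \<le> \<kappa> * ?E (wt i) + t" .
  have Hj: "expectation (\<lambda>\<omega>. ?g (wt j) (wsum wt X (D - {j}) \<omega>)) =
     (1 - expectation (X i)) * ?E (wt j) +
     expectation (X i) * expectation (\<lambda>\<omega>. ?g (wt j) (wsum wt X ?D \<omega> + wt i))" (is "?Hj = _")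
    using Rj.expectation_split[of i "?g (wt j)"] ij by (simp add: eqD)
  \<comment> \<open>For \<open>i\<close> the opposite direction is needed: the unshifted window is
    split with the weights of the mixture over \<open>X i\<close>, and each part is bounded by the
    matching branch.\<close>
  have "?E (wt j) = (1 - expectation (X i)) * ?E (wt j) + expectation (X i) * ?E (wt j)"
    by (simp add: algebra_simps)
  also have "\<dots> \<le> (1 - expectation (X i)) * (\<kappa> * ?E (wt j) + t) +
      expectation (X i) * (\<kappa> * expectation (\<lambda>\<omega>. ?g (wt j) (wsum wt X ?D \<omega> + wt i)) + t)"
    by (intro add_mono mult_left_mono up E0 R.shift_invariantD(2)[OF sa]) (use EX ij in auto)
  also have "\<dots> = \<kappa> * ?Hj + t" unfolding Hj by (simp add: algebra_simps)
  finally have 2: "?E (wt j) \<le> \<kappa> * ?Hj + t" .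
  have 3: "k * ?E (wt i) \<le> \<kappa> ^ (k + l) * (l * ?E (wt j) + (real l ^ 2 + real k ^ 2) * t)"
    by (rule R.window_compare[OF sa sb \<kappa> t w])
  have "l * ?E (wt j) + (real l ^ 2 + real k ^ 2) * t \<le> l * (\<kappa> * ?Hj + t) + (real l ^ 2 + real k ^ 2) * t"
    using 2 by (intro add_mono mult_left_mono) auto
  also have "\<dots> = \<kappa> * (l * ?Hj) + 1 * ((l + real l ^ 2 + real k ^ 2) * t)"
    by (simp add: algebra_simps)
  also have "\<dots> \<le> \<kappa> * (l * ?Hj) + \<kappa> * ((l + real l ^ 2 + real k ^ 2) * t)"
    using \<kappa> t by (intro add_mono mult_right_mono) auto
  finally have 4: "l * ?E (wt j) + (real l ^ 2 + real k ^ 2) * t \<le> \<kappa> * (l * ?Hj + (l + real l ^ 2 + real k ^ 2) * t)"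
    by (simp add: algebra_simps)
  have "k * expectation (\<lambda>\<omega>. ?g (wt i) (wsum wt X (D - {i}) \<omega>)) \<le> k * (\<kappa> * ?E (wt i) + t)"
    using 1 by (intro mult_left_mono) auto
  also have "\<dots> = \<kappa> * (k * ?E (wt i)) + 1 * (k * t)" by (simp add: algebra_simps)
  \<comment> \<open>The exponent is \<open>k + l\<close> for the window comparison plus one factor
    each for restoring \<open>j\<close> and \<open>i\<close>.\<close>
  also have "\<dots> \<le> \<kappa> * (\<kappa> ^ (k + l) * (\<kappa> * (l * ?Hj + (l + real l ^ 2 + real k ^ 2) * t))) + \<kappa> ^ (k + l + 2) * (k * t)"
    using \<kappa> t by (intro add_mono mult_left_mono mult_right_mono one_le_power order_trans[OF 3] 4) auto
  also have "\<dots> = \<kappa> ^ (k + l + 2) * (l * ?Hj + (l + k + real l ^ 2 + real k ^ 2) * t)"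
    by (simp add: power_add power2_eq_square algebra_simps)
  finally show ?thesis unfolding t_def .
qed

section \<open>The pivot event and its integral representation\<close>

lemma bij_betw_rank:
  fixes v :: "'i \<Rightarrow> real"
  assumes "finite A" "inj_on v A"
  shows "bij_betw (\<lambda>i. card {l \<in> A. v l < v i}) A {..<card A}"
proof (rule bij_betw_imageI)
  let ?r = "\<lambda>i. card {l \<in> A. v l < v i}"
  have less: "?r i < ?r j" if "i \<in> A" "v i < v j" for i j
  proof (rule psubset_card_mono)
    have "{l \<in> A. v l < v i} \<subseteq> {l \<in> A. v l < v j}" using that(2) by (auto intro: less_trans)
    moreover have "i \<in> {l \<in> A. v l < v j}" "i \<notin> {l \<in> A. v l < v i}" using that by auto
    ultimately show "{l \<in> A. v l < v i} \<subset> {l \<in> A. v l < v j}" by blast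
  qed (use assms(1) in simp)
  show "inj_on ?r A"
  proof (rule inj_onI)
    fix i j assume ij: "i \<in> A" "j \<in> A" "?r i = ?r j"
    have "\<not> v i < v j"
    proof
      assume "v i < v j"
      then have "?r i < ?r j" by (rule less[OF ij(1)])
      then show False using ij(3) by linarith
    qed
    moreover have "\<not> v j < v i"
    proof
      assume "v j < v i"
      then have "?r j < ?r i" by (rule less[OF ij(2)])
      then show False using ij(3) by linarith
    qed
    ultimately have "v i = v j" by simp
    then show "i = j" using ij assms(2) by (auto dest: inj_onD)
  qed
  moreover have "?r ` A \<subseteq> {..<card A}"
    using assms(1) by (auto intro!: psubset_card_mono)
  ultimately show "?r ` A = {..<card A}"
    by (intro card_subset_eq) (auto simp: card_image)
qed

context
  fixes lam :: "nat \<Rightarrow> 'a \<Rightarrow> real" and wt :: "nat \<Rightarrow> real" and m :: nat and \<omega> :: 'a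
  assumes inj: "inj_on (\<lambda>l. lam l \<omega>) {1..m}"
begin

private abbreviation "brank i \<equiv> card {l \<in> {1..m}. lam l \<omega> < lam i \<omega>}"

lemma rank_bij: "bij_betw (\<lambda>i. brank i) {1..m} {..<m}"
  using bij_betw_rank[OF _ inj] by simp

text \<open>Positions count from 1 and ranks from 0, hence the \<open>Suc\<close>.\<close>

lemma ord_idx_rank:
  assumes "i \<in> {1..m}"
  shows "ord_idx lam m \<omega> (Suc (brank i)) = i"
  unfolding ord_idx_def
  by (rule the_equality) (use assms rank_bij in \<open>auto simp: bij_betw_def dest: inj_onD\<close>)

lemma ord_idx_surj:
  assumes "k \<in> {1..m}"
  obtains i where "i \<in> {1..m}" "k = Suc (brank i)" "ord_idx lam m \<omega> k = i"
proof -
  have "k - 1 \<in> (\<lambda>i. brank i) ` {1..m}"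
    using rank_bij assms by (auto simp: bij_betw_def)
  then obtain i where "i \<in> {1..m}" "k - 1 = brank i" by auto
  then have "i \<in> {1..m}" "k = Suc (brank i)" using assms by auto
  then show ?thesis using that ord_idx_rank by blast
qed

text \<open>Turns a partial sum over positions into the weight of a set of representatives, which is
  visibly monotone in \<open>j\<close> and can be identified when \<open>j\<close> is the rank of
  \<open>i\<close>.\<close>

lemma sum_ord_idx:
  assumes "j \<le> m"
  shows "(\<Sum>k=1..j. wt (ord_idx lam m \<omega> k)) = (\<Sum>l | l \<in> {1..m} \<and> brank l < j. wt l)"
proof (rule sum.reindex_bij_witness[of _ "\<lambda>l. Suc (brank l)" "ord_idx lam m \<omega>"])
  fix k assume "k \<in> {1..j}"
  with assms have k: "k \<in> {1..m}" "k \<le> j" by auto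
  from ord_idx_surj[OF k(1)] obtain i where i: "i \<in> {1..m}" "k = Suc (brank i)" "ord_idx lam m \<omega> k = i" .
  show "Suc (brank (ord_idx lam m \<omega> k)) = k" using i by metis
  show "ord_idx lam m \<omega> k \<in> {l. l \<in> {1..m} \<and> brank l < j}" using i k by (metis (no_types, lifting) Suc_le_lessD mem_Collect_eq)
qed (use ord_idx_rank in auto)

text \<open>The partial sums first exceed the quota at the position of \<open>i\<close> exactly if
  the weight before \<open>i\<close> does not exceed it and the weight including \<open>i\<close>
  does. The weight before \<open>i\<close> is that of the representatives to its left.\<close>

lemma pivot_iff:
  assumes wt: "\<And>l. l \<in> {1..m} \<Longrightarrow> 0 \<le> wt l" and pos: "quota wt m > 0" and i: "i \<in> {1..m}"
  shows "ord_idx lam m \<omega> (pivot_pos lam wt m \<omega>) = i \<longleftrightarrow>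
    (\<Sum>l\<in>{1..m} - {i}. wt l * (if lam l \<omega> < lam i \<omega> then 1 else 0)) \<in> {quota wt m - wt i<..quota wt m}"
    (is "?L \<longleftrightarrow> ?R")
    and "pivot_pos lam wt m \<omega> \<in> {1..m}"
proof -
  define S where "S j = (\<Sum>k=1..j. wt (ord_idx lam m \<omega> k))" for j
  have S0: "S 0 = 0" by (simp add: S_def)
  have P: "pivot_pos lam wt m \<omega> = (LEAST j. j \<in> {1..m} \<and> S j > quota wt m)"
    by (simp add: pivot_pos_def S_def)
  have all: "{l. l \<in> {1..m} \<and> brank l < m} = {1..m}"
    using bij_betw_apply[OF rank_bij] by auto
  have "S m = (\<Sum>l=1..m. wt l)"
    unfolding S_def sum_ord_idx[OF order_refl] all ..
  \<comment> \<open>The total weight is twice the quota, so positivity of the quota ensures that the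
    \<open>LEAST\<close> in the pivotal position is attained.\<close>
  then have "S m > quota wt m" using pos by (simp add: quota_def)
  moreover from i have "m \<in> {1..m}" by simp
  ultimately have ex: "m \<in> {1..m} \<and> S m > quota wt m" by blast
  have LP: "pivot_pos lam wt m \<omega> \<in> {1..m} \<and> S (pivot_pos lam wt m \<omega>) > quota wt m"
    unfolding P by (rule LeastI[of _ m]) (rule ex)
  then show "pivot_pos lam wt m \<omega> \<in> {1..m}" by blast
  have mono: "S j \<le> S j'" if "j \<le> j'" "j' \<le> m" for j j'
  proof -
    from that have "S j = (\<Sum>l | l \<in> {1..m} \<and> brank l < j. wt l)" "S j' = (\<Sum>l | l \<in> {1..m} \<and> brank l < j'. wt l)"
      unfolding S_def by (intro sum_ord_idx; simp)+
    then show ?thesis using wt that by (auto intro!: sum_mono2)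
  qed
  have ri: "brank i < m" using bij_betw_apply[OF rank_bij i] by simp
  have B: "S (brank i) = (\<Sum>l\<in>{1..m} - {i}. wt l * (if lam l \<omega> < lam i \<omega> then 1 else 0))"
    and A: "S (Suc (brank i)) = S (brank i) + wt i"
  proof -
    have ge: "brank i \<le> brank l" if "lam i \<omega> \<le> lam l \<omega>" for l
      using that by (intro card_mono) auto
    have lt: "brank l < brank i" if "lam l \<omega> < lam i \<omega>" "l \<in> {1..m}" for l
      using that by (intro psubset_card_mono) auto
    have sub: "{l. l \<in> {1..m} \<and> brank l < brank i} = {l \<in> {1..m} - {i}. lam l \<omega> < lam i \<omega>}"
    proof (intro set_eqI iffI)
      fix l assume l: "l \<in> {l. l \<in> {1..m} \<and> brank l < brank i}"
      then have "lam l \<omega> < lam i \<omega>" using ge[of l] by force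
      then show "l \<in> {l \<in> {1..m} - {i}. lam l \<omega> < lam i \<omega>}" using l by auto
    next
      fix l assume "l \<in> {l \<in> {1..m} - {i}. lam l \<omega> < lam i \<omega>}"
      then show "l \<in> {l. l \<in> {1..m} \<and> brank l < brank i}" using lt[of l] by blast
    qed
    have "S (brank i) = (\<Sum>l\<in>{l \<in> {1..m} - {i}. lam l \<omega> < lam i \<omega>}. wt l)"
      unfolding S_def using sum_ord_idx[of "brank i"] ri sub by simp
    also have "\<dots> = (\<Sum>l\<in>{1..m} - {i}. if lam l \<omega> < lam i \<omega> then wt l else 0)"
      by (rule sum.inter_filter) simp
    finally show "S (brank i) = (\<Sum>l\<in>{1..m} - {i}. wt l * (if lam l \<omega> < lam i \<omega> then 1 else 0))"
      by (simp add: if_distrib cong: if_cong)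
    show "S (Suc (brank i)) = S (brank i) + wt i"
      unfolding S_def using ord_idx_rank[OF i] by simp
  qed
  show "?L \<longleftrightarrow> ?R"
  proof
    assume L: ?L
    from LP obtain i' where "i' \<in> {1..m}" "pivot_pos lam wt m \<omega> = Suc (brank i')"
       "ord_idx lam m \<omega> (pivot_pos lam wt m \<omega>) = i'" using ord_idx_surj by blast
    with L have p: "pivot_pos lam wt m \<omega> = Suc (brank i)" by simp
    have "\<not> S (brank i) > quota wt m"
    proof
      assume c: "S (brank i) > quota wt m"
      \<comment> \<open>Position 0 is outside the range of the \<open>LEAST\<close>, so rank 0 is
        excluded separately: the empty partial sum is below the positive quota.\<close>
      then have "brank i \<noteq> 0" using pos S0 by (metis less_asym)
      then have "1 \<le> brank i" by linarith
      then have "brank i \<in> {1..m}" by (rule atLeastAtMost_iff[THEN iffD2, OF conjI]) (use ri in linarith)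
      then have "pivot_pos lam wt m \<omega> \<le> brank i" unfolding P using c by (intro Least_le) auto
      then show False using p by simp
    qed
    then show ?R using LP p A B by auto
  next
    assume R: ?R
    have "pivot_pos lam wt m \<omega> = Suc (brank i)"
      unfolding P
    proof (rule Least_equality)
      show "Suc (brank i) \<in> {1..m} \<and> quota wt m < S (Suc (brank i))" using ri A B R by auto
      fix j assume j: "j \<in> {1..m} \<and> quota wt m < S j"
      show "Suc (brank i) \<le> j"
      proof (rule ccontr)
        assume "\<not> Suc (brank i) \<le> j"
        then have "S j \<le> S (brank i)" using ri by (intro mono) auto
        then show False using R B j by auto
      qed
    qed
    then show ?L using ord_idx_rank[OF i] by simp
  qed
qed

end

section \<open>Measurability and conditioning on one ideal point\<close>

text \<open>The pivot depends on \<omega> only through the finite pattern \<open>cmp\<close> of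
  strict comparisons, also on ties, where \<open>THE\<close> may be unspecified but remains a
  function of the pattern. The event is thus a finite union of comparison events.\<close>

lemma pivot_event_measurable:
  assumes lam: "\<And>l. l \<in> {1..m} \<Longrightarrow> lam l \<in> borel_measurable M"
  shows "{\<omega> \<in> space M. ord_idx lam m \<omega> (pivot_pos lam wt m \<omega>) = i} \<in> sets M"
proof -
  define cmp where "cmp \<omega> = {(l, k). l \<in> {1..m} \<and> k \<in> {1..m} \<and> lam l \<omega> < lam k \<omega>}" for \<omega>
  define idx where "idx C k = (THE i. i \<in> {1..m} \<and> card {l \<in> {1..m}. (l, i) \<in> C} = k - 1)" for C k
  define G where "G C = idx C (LEAST j. j \<in> {1..m} \<and> (\<Sum>k=1..j. wt (idx C k)) > quota wt m)" for C
  have o: "ord_idx lam m \<omega> k = idx (cmp \<omega>) k" for \<omega> k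
  proof -
    have "{l \<in> {1..m}. (l, i) \<in> cmp \<omega>} = {l \<in> {1..m}. lam l \<omega> < lam i \<omega>}" if "i \<in> {1..m}" for i
      using that by (auto simp: cmp_def)
    then show ?thesis
      unfolding ord_idx_def idx_def by (intro arg_cong[where f=The] ext conj_cong) auto
  qed
  have G: "ord_idx lam m \<omega> (pivot_pos lam wt m \<omega>) = G (cmp \<omega>)" for \<omega>
    unfolding pivot_pos_def o G_def ..
  let ?P = "Pow ({1..m} \<times> {1..m})"
  have "{\<omega> \<in> space M. G (cmp \<omega>) = i} = (\<Union>C\<in>{C \<in> ?P. G C = i}. {\<omega> \<in> space M. cmp \<omega> = C})"
    by (auto simp: cmp_def)
  also have "\<dots> \<in> sets M"
  proof (rule sets.finite_UN)
    fix C assume C: "C \<in> {C \<in> ?P. G C = i}"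
    have "{\<omega> \<in> space M. cmp \<omega> = C} =
      {\<omega> \<in> space M. \<forall>l\<in>{1..m}. \<forall>k\<in>{1..m}. (l, k) \<in> C \<longleftrightarrow> lam l \<omega> < lam k \<omega>}"
      using C by (auto simp: cmp_def)
    also have "\<dots> \<in> sets M" using lam by measurable
    finally show "{\<omega> \<in> space M. cmp \<omega> = C} \<in> sets M" .
  qed (rule finite_subset[of _ ?P], auto)
  finally show ?thesis by (simp add: G)
qed

text \<open>Fubini for the joint law, which is a product by independence: the inner probability has
  the first variable frozen at x.\<close>

lemma (in prob_space) indep_var_prob_conditional:
  assumes ind: "indep_var N1 X N2 Y" and Q: "Q \<in> sets (N1 \<Otimes>\<^sub>M N2)"
  shows "prob {\<omega> \<in> space M. (X \<omega>, Y \<omega>) \<in> Q} =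
      (\<integral>x. prob {\<omega> \<in> space M. (x, Y \<omega>) \<in> Q} \<partial>distr M N1 X)"
    and "(\<lambda>x. prob {\<omega> \<in> space M. (x, Y \<omega>) \<in> Q}) \<in> borel_measurable N1"
proof -
  have rv [measurable]: "X \<in> measurable M N1" "Y \<in> measurable M N2"
    and eq: "distr M N1 X \<Otimes>\<^sub>M distr M N2 Y = distr M (N1 \<Otimes>\<^sub>M N2) (\<lambda>\<omega>. (X \<omega>, Y \<omega>))"
    using ind unfolding indep_var_distribution_eq by auto
  interpret X: prob_space "distr M N1 X" by (rule prob_space_distr) fact
  interpret Y: prob_space "distr M N2 Y" by (rule prob_space_distr) fact
  have Q': "Q \<in> sets (N1 \<Otimes>\<^sub>M distr M N2 Y)" "Q \<in> sets (distr M N1 X \<Otimes>\<^sub>M distr M N2 Y)"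
    using Q by (simp_all cong: sets_pair_measure_cong)
  have slice: "emeasure (distr M N2 Y) (Pair x -` Q) = prob {\<omega> \<in> space M. (x, Y \<omega>) \<in> Q}" for x
  proof -
    have "Pair x -` Q \<in> sets N2" using Q by (rule sets_Pair1)
    then have "emeasure (distr M N2 Y) (Pair x -` Q) = emeasure M (Y -` (Pair x -` Q) \<inter> space M)"
      by (rule emeasure_distr[OF rv(2)])
    also have "Y -` (Pair x -` Q) \<inter> space M = {\<omega> \<in> space M. (x, Y \<omega>) \<in> Q}" by auto
    finally show ?thesis by (simp add: emeasure_eq_measure)
  qed
  have "(\<lambda>x. emeasure (distr M N2 Y) (Pair x -` Q)) \<in> borel_measurable N1"
    using Y.measurable_emeasure_Pair[OF Q'(1)] .
  then have "(\<lambda>x. enn2real (ennreal (prob {\<omega> \<in> space M. (x, Y \<omega>) \<in> Q}))) \<in> borel_measurable N1"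
    unfolding slice by measurable
  then show meas: "(\<lambda>x. prob {\<omega> \<in> space M. (x, Y \<omega>) \<in> Q}) \<in> borel_measurable N1"
    by simp
  have "emeasure M {\<omega> \<in> space M. (X \<omega>, Y \<omega>) \<in> Q} =
      emeasure (distr M (N1 \<Otimes>\<^sub>M N2) (\<lambda>\<omega>. (X \<omega>, Y \<omega>))) Q"
    using Q by (subst emeasure_distr) (auto intro!: arg_cong[where f="emeasure M"])
  also have "\<dots> = (\<integral>\<^sup>+x. prob {\<omega> \<in> space M. (x, Y \<omega>) \<in> Q} \<partial>distr M N1 X)"
    unfolding eq[symmetric] Y.emeasure_pair_measure_alt[OF Q'(2)] slice ..
  also have "\<dots> = ennreal (\<integral>x. prob {\<omega> \<in> space M. (x, Y \<omega>) \<in> Q} \<partial>distr M N1 X)"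
    by (rule nn_integral_eq_integral, rule X.integrable_const_bound[of _ 1]) (use meas in auto)
  finally show "prob {\<omega> \<in> space M. (X \<omega>, Y \<omega>) \<in> Q} =
      (\<integral>x. prob {\<omega> \<in> space M. (x, Y \<omega>) \<in> Q} \<partial>distr M N1 X)"
    by (simp add: emeasure_eq_measure integral_nonneg_AE)
qed

lemma window_set_measurable:
  fixes D :: "'i set" and wt :: "'i \<Rightarrow> real"
  assumes "finite D"
  shows "{p \<in> space (borel \<Otimes>\<^sub>M (\<Pi>\<^sub>M l\<in>D. borel)).
      (\<Sum>l\<in>D. wt l * (if snd p l < (fst p :: real) then 1 else 0)) \<in> {a<..b::real}} \<in> sets (borel \<Otimes>\<^sub>M (\<Pi>\<^sub>M l\<in>D. borel))"
proof -
  let ?N = "borel \<Otimes>\<^sub>M (\<Pi>\<^sub>M l\<in>D. borel) :: (real \<times> ('i \<Rightarrow> real)) measure"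
  have "(\<lambda>p. wt l * (if snd p l < fst p then 1 else 0)) \<in> borel_measurable ?N" if "l \<in> D" for l
  proof -
    have [measurable]: "(\<lambda>p. snd p l) \<in> borel_measurable ?N"
      by (rule measurable_compose[OF measurable_snd measurable_component_singleton[OF that]])
    show ?thesis by measurable
  qed
  then have "(\<lambda>p. \<Sum>l\<in>D. wt l * (if snd p l < fst p then 1 else 0)) \<in> borel_measurable ?N"
    by (rule borel_measurable_sum)
  then have "(\<lambda>p. \<Sum>l\<in>D. wt l * (if snd p l < fst p then 1 else 0)) -` {a<..b} \<inter> space ?N \<in> sets ?N"
    by (rule measurable_sets) simp
  also have "(\<lambda>p. \<Sum>l\<in>D. wt l * (if snd p l < fst p then 1 else 0)) -` {a<..b} \<inter> space ?N =
      {p \<in> space ?N. (\<Sum>l\<in>D. wt l * (if snd p l < fst p then 1 else 0)) \<in> {a<..b}}"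
    by blast
  finally show ?thesis .
qed

definition below :: "(nat \<Rightarrow> 'a \<Rightarrow> real) \<Rightarrow> real \<Rightarrow> nat \<Rightarrow> 'a \<Rightarrow> real" where
  "below lam x l \<omega> = (if lam l \<omega> < x then 1 else 0)"

locale assembly = prob_space M for M :: "'a measure" +
  fixes lam :: "nat \<Rightarrow> 'a \<Rightarrow> real" and wt :: "nat \<Rightarrow> real" and g :: "nat \<Rightarrow> real \<Rightarrow> real"
  assumes wt_nonneg: "\<And>k. k \<ge> 1 \<Longrightarrow> 0 \<le> wt k"
    and g_meas [measurable]: "\<And>k. k \<ge> 1 \<Longrightarrow> g k \<in> borel_measurable borel"
    and g_nonneg: "\<And>k x. k \<ge> 1 \<Longrightarrow> 0 \<le> g k x"
    and indep: "indep_vars (\<lambda>_. borel) lam {1..}"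
    and distr_lam: "\<And>k. k \<ge> 1 \<Longrightarrow> distributed M lborel (lam k) (\<lambda>x. ennreal (g k x))"
begin

lemma lam_measurable [measurable]: "k \<ge> 1 \<Longrightarrow> lam k \<in> borel_measurable M"
  using indep by (auto simp: indep_vars_def)

lemma distr_eq: "k \<ge> 1 \<Longrightarrow> distr M borel (lam k) = density lborel (\<lambda>x. ennreal (g k x))"
  using distributed_distr_eq_density[OF distr_lam, of k] by (simp cong: distr_cong)

lemma distr_integral:
  assumes "k \<ge> 1" and [measurable]: "h \<in> borel_measurable borel"
  shows "(\<integral>x. h x \<partial>distr M borel (lam k)) = (\<integral>x. g k x * h x \<partial>lborel)"
  unfolding distr_eq[OF assms(1)] using assms g_nonneg by (subst integral_density) auto

lemma prob_lam_eq: "k \<ge> 1 \<Longrightarrow> prob {\<omega> \<in> space M. lam k \<omega> = x} = 0"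
proof -
  assume k: "k \<ge> 1"
  have [measurable]: "g k \<in> borel_measurable borel" using g_meas[OF k] .
  have "prob {\<omega> \<in> space M. lam k \<omega> = x} = measure (distr M borel (lam k)) {x}"
    using k by (subst measure_distr) (auto intro!: arg_cong[where f=prob])
  also have "emeasure (density lborel (\<lambda>x. ennreal (g k x))) {x} = 0"
  proof -
    have "(\<integral>\<^sup>+y. ennreal (g k y) * indicator {x} y \<partial>lborel) = 0"
      by (subst nn_integral_0_iff_AE) (auto intro!: AE_I[where N="{x}"] simp: indicator_def)
    then show ?thesis by (subst emeasure_density) auto
  qed
  then have "measure (distr M borel (lam k)) {x} = 0"
    unfolding distr_eq[OF k] measure_def by simp
  finally show ?thesis .
qed

text \<open>Independence of blocks is available for restrictions of the family, so
  \<open>lam i\<close> is carried as a function on \<open>{i}\<close>; \<open>Q'\<close> is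
  \<open>Q\<close> pulled back along evaluation at \<open>i\<close>, and evaluation is undone at the
  end.\<close>

lemma lam_prob_conditional:
  assumes i: "i \<ge> 1" and A: "A \<subseteq> {1..}" "i \<notin> A"
    and Q [measurable]: "Q \<in> sets (borel \<Otimes>\<^sub>M (\<Pi>\<^sub>M l\<in>A. borel))"
  shows "prob {\<omega> \<in> space M. (lam i \<omega>, \<lambda>l\<in>A. lam l \<omega>) \<in> Q} =
      (\<integral>x. prob {\<omega> \<in> space M. (x, \<lambda>l\<in>A. lam l \<omega>) \<in> Q} \<partial>distr M borel (lam i))"
    and "(\<lambda>x. prob {\<omega> \<in> space M. (x, \<lambda>l\<in>A. lam l \<omega>) \<in> Q}) \<in> borel_measurable borel"
proof -
  let ?N = "\<Pi>\<^sub>M l\<in>{i}. borel :: real measure" and ?X = "\<lambda>\<omega>. \<lambda>l\<in>{i}. lam l \<omega>"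
  have ind: "indep_var ?N ?X (\<Pi>\<^sub>M l\<in>A. borel) (\<lambda>\<omega>. \<lambda>l\<in>A. lam l \<omega>)"
    using i A by (intro indep_var_restrict[OF indep]) auto
  have [measurable]: "(\<lambda>y. y i) \<in> measurable ?N borel"
    by (rule measurable_component_singleton) simp
  have X [measurable]: "?X \<in> measurable M ?N" using i by (intro measurable_restrict) auto
  define Q' where "Q' = {p \<in> space (?N \<Otimes>\<^sub>M (\<Pi>\<^sub>M l\<in>A. borel)). (fst p i, snd p) \<in> Q}"
  have Q': "Q' \<in> sets (?N \<Otimes>\<^sub>M (\<Pi>\<^sub>M l\<in>A. borel))" unfolding Q'_def by measurable
  have slice: "{\<omega> \<in> space M. (y, \<lambda>l\<in>A. lam l \<omega>) \<in> Q'} = {\<omega> \<in> space M. (y i, \<lambda>l\<in>A. lam l \<omega>) \<in> Q}"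
    if "y \<in> space ?N" for y
    using that by (auto simp: Q'_def space_pair_measure space_PiM)
  let ?h = "\<lambda>x. prob {\<omega> \<in> space M. (x, \<lambda>l\<in>A. lam l \<omega>) \<in> Q}"
  have "(\<lambda>y. ?h (y i)) \<in> borel_measurable ?N"
    using indep_var_prob_conditional(2)[OF ind Q'] slice by (simp cong: measurable_cong)
  moreover have "(\<lambda>x. \<lambda>l\<in>{i}. x) \<in> measurable borel ?N" by (intro measurable_restrict) auto
  ultimately show h [measurable]: "?h \<in> borel_measurable borel"
    using measurable_compose[of "\<lambda>x. \<lambda>l\<in>{i}. x" borel ?N "\<lambda>y. ?h (y i)" borel] by simp
  have "prob {\<omega> \<in> space M. (lam i \<omega>, \<lambda>l\<in>A. lam l \<omega>) \<in> Q} =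
      prob {\<omega> \<in> space M. (?X \<omega>, \<lambda>l\<in>A. lam l \<omega>) \<in> Q'}"
    by (intro arg_cong[where f=prob]) (auto simp: Q'_def space_pair_measure space_PiM)
  also have "\<dots> = (\<integral>y. prob {\<omega> \<in> space M. (y, \<lambda>l\<in>A. lam l \<omega>) \<in> Q'} \<partial>distr M ?N ?X)"
    by (rule indep_var_prob_conditional(1)[OF ind Q'])
  also have "\<dots> = (\<integral>y. ?h (y i) \<partial>distr M ?N ?X)"
    by (rule Bochner_Integration.integral_cong[OF refl]) (simp add: slice)
  also have "\<dots> = (\<integral>\<omega>. ?h (lam i \<omega>) \<partial>M)"
    by (subst integral_distr[OF X]) auto
  also have "\<dots> = (\<integral>x. ?h x \<partial>distr M borel (lam i))"
    using i by (subst integral_distr) auto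
  finally show "prob {\<omega> \<in> space M. (lam i \<omega>, \<lambda>l\<in>A. lam l \<omega>) \<in> Q} =
      (\<integral>x. ?h x \<partial>distr M borel (lam i))" .
qed

text \<open>Conditioning one of two ideal points on its value leaves the event that the other hits a
  given point, which is null because its law has a density. Finitely many pairs are then
  combined.\<close>

lemma AE_distinct: "AE \<omega> in M. inj_on (\<lambda>l. lam l \<omega>) {1..m}"
proof -
  have ne: "AE \<omega> in M. lam k \<omega> \<noteq> lam l \<omega>" if kl: "k \<ge> 1" "l \<ge> 1" "k \<noteq> l" for k l
  proof -
    have ind: "indep_var borel (lam k) borel (lam l)"
    proof -
      have "indep_var borel ((\<lambda>f. f k) \<circ> (\<lambda>\<omega>. restrict (\<lambda>l. lam l \<omega>) {k}))
          borel ((\<lambda>f. f l) \<circ> (\<lambda>\<omega>. restrict (\<lambda>l. lam l \<omega>) {l}))"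
        using kl by (intro indep_var_compose[OF indep_var_restrict[OF indep]]) auto
      then show ?thesis by (simp add: comp_def)
    qed
    have "{p \<in> space (borel \<Otimes>\<^sub>M borel). fst p = (snd p :: real)} \<in> sets (borel \<Otimes>\<^sub>M borel)" by measurable
    from indep_var_prob_conditional(1)[OF ind this]
    have "prob {\<omega> \<in> space M. lam k \<omega> = lam l \<omega>} = (\<integral>x. prob {\<omega> \<in> space M. x = lam l \<omega>} \<partial>distr M borel (lam k))"
      by (simp add: space_pair_measure)
    also have "\<dots> = 0"
    proof -
      have "{\<omega> \<in> space M. x = lam l \<omega>} = {\<omega> \<in> space M. lam l \<omega> = x}" for x by auto
      then show ?thesis using prob_lam_eq[OF kl(2)] by simp
    qed
    finally show ?thesis
      using kl by (subst AE_iff_measurable[OF _ refl]) (auto simp: emeasure_eq_measure)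
  qed
  have "AE \<omega> in M. \<forall>k\<in>{1..m}. \<forall>l\<in>{1..m}. k \<noteq> l \<longrightarrow> lam k \<omega> \<noteq> lam l \<omega>"
    using ne by (intro AE_finite_allI) (auto simp: AE_conj_iff)
  then show ?thesis by eventually_elim (auto intro!: inj_onI)
qed

text \<open>The function H_i of the overview, written as the expectation of an indicator so that the
  bounds for test functions apply to it directly.\<close>

definition window :: "nat \<Rightarrow> nat \<Rightarrow> real \<Rightarrow> real" where
  "window m i x = expectation (\<lambda>\<omega>. indicator {quota wt m - wt i<..quota wt m}
     (wsum wt (below lam x) ({1..m} - {i}) \<omega>))"

lemma bernoulli_below: "bernoulli_family M {1..m} (below lam x)"
proof unfold_locales
  show "indep_vars (\<lambda>_. borel) (below lam x) {1..m}"
    unfolding below_def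
    by (rule indep_vars_compose2[OF indep_vars_subset[OF indep]]) auto
qed (auto simp: below_def)

lemma window_prob:
  "window m i x = prob {\<omega> \<in> space M. wsum wt (below lam x) ({1..m} - {i}) \<omega> \<in> {quota wt m - wt i<..quota wt m}}"
proof -
  interpret bernoulli_family M "{1..m}" "below lam x" wt by (rule bernoulli_below)
  have [measurable]: "wsum wt (below lam x) ({1..m} - {i}) \<in> borel_measurable M"
    by (rule wsum_measurable) auto
  have "window m i x = expectation (indicator {\<omega> \<in> space M. wsum wt (below lam x) ({1..m} - {i}) \<omega> \<in> {quota wt m - wt i<..quota wt m}})"
    unfolding window_def by (intro Bochner_Integration.integral_cong) (auto simp: indicator_def)
  then show ?thesis by simp
qed

lemma window_01: "0 \<le> window m i x" "window m i x \<le> 1"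
  unfolding window_prob by auto

text \<open>Almost surely the pivot event says that \<open>lam i\<close> together with the other
  ideal points lies in \<open>?Q\<close>; the slice of \<open>?Q\<close> at x is the window event.
  Integrability is kept as a second claim for the later pointwise comparison of integrands.\<close>

lemma pivot_prob_eq_window:
  assumes pos: "quota wt m > 0" and i: "i \<in> {1..m}"
  shows "pivot_prob M lam wt m i = (\<integral>x. g i x * window m i x \<partial>lborel)"
    and "integrable lborel (\<lambda>x. g i x * window m i x)"
proof -
  let ?D = "{1..m} - {i}" and ?I = "{quota wt m - wt i<..quota wt m}"
  let ?Q = "{p \<in> space (borel \<Otimes>\<^sub>M (\<Pi>\<^sub>M l\<in>?D. borel)). (\<Sum>l\<in>?D. wt l * (if snd p l < (fst p :: real) then 1 else 0)) \<in> ?I}"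
  have Q: "?Q \<in> sets (borel \<Otimes>\<^sub>M (\<Pi>\<^sub>M l\<in>?D. borel))"
    by (rule window_set_measurable) simp
  have D: "i \<ge> 1" "?D \<subseteq> {1..}" "i \<notin> ?D" using i by auto
  have slice: "{\<omega> \<in> space M. (x, \<lambda>l\<in>?D. lam l \<omega>) \<in> ?Q} =
     {\<omega> \<in> space M. wsum wt (below lam x) ?D \<omega> \<in> ?I}" for x
    by (auto simp: space_pair_measure space_PiM wsum_def below_def)
  have meas [measurable]: "window m i \<in> borel_measurable borel"
    using lam_prob_conditional(2)[OF D Q] unfolding slice window_prob .
  have [measurable]: "lam l \<in> borel_measurable M" if "l \<in> {1..m}" for l using that by simp
  have gi [measurable]: "g i \<in> borel_measurable borel" using i by simp
  have "pivot_prob M lam wt m i = prob {\<omega> \<in> space M. (lam i \<omega>, \<lambda>l\<in>?D. lam l \<omega>) \<in> ?Q}"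
    unfolding pivot_prob_def
  proof (rule measure_eq_AE)
    show "{\<omega> \<in> space M. ord_idx lam m \<omega> (pivot_pos lam wt m \<omega>) = i} \<in> sets M"
      by (rule pivot_event_measurable) simp
    have "(\<lambda>\<omega>. (lam i \<omega>, \<lambda>l\<in>?D. lam l \<omega>)) \<in> measurable M (borel \<Otimes>\<^sub>M (\<Pi>\<^sub>M l\<in>?D. borel))"
      using i by (intro measurable_Pair measurable_restrict) auto
    from measurable_sets[OF this Q]
    show "{\<omega> \<in> space M. (lam i \<omega>, \<lambda>l\<in>?D. lam l \<omega>) \<in> ?Q} \<in> sets M"
      by (simp add: vimage_def Int_def conj_commute)
    show "AE \<omega> in M. (\<omega> \<in> {\<omega> \<in> space M. ord_idx lam m \<omega> (pivot_pos lam wt m \<omega>) = i}) =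
       (\<omega> \<in> {\<omega> \<in> space M. (lam i \<omega>, \<lambda>l\<in>?D. lam l \<omega>) \<in> ?Q})"
      using AE_distinct[of m]
    proof eventually_elim
      case (elim \<omega>)
      show ?case
        using pivot_iff(1)[where lam=lam and \<omega>=\<omega> and wt=wt and m=m, OF elim _ pos i] wt_nonneg
        by (auto simp: space_pair_measure space_PiM)
    qed
  qed
  also have "\<dots> = (\<integral>x. window m i x \<partial>distr M borel (lam i))"
    unfolding lam_prob_conditional(1)[OF D Q] slice window_prob ..
  also have "\<dots> = (\<integral>x. g i x * window m i x \<partial>lborel)"
    using i by (intro distr_integral) auto
  finally show "pivot_prob M lam wt m i = (\<integral>x. g i x * window m i x \<partial>lborel)" .
  have "prob_space (distr M borel (lam i))" using i by (intro prob_space_distr) simp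
  then interpret d: prob_space "density lborel (\<lambda>x. ennreal (g i x))" using i distr_eq by simp
  have "integrable (density lborel (\<lambda>x. ennreal (g i x))) (window m i)"
    by (rule d.integrable_const_bound[of _ 1]) (use window_01 in auto)
  then show "integrable lborel (\<lambda>x. g i x * window m i x)"
    using i g_nonneg by (subst (asm) integrable_density) auto
qed

text \<open>The events are fibres of a single function, hence disjoint. They exhaust the space
  almost surely since for distinct ideal points the pivotal position lies in \<open>{1..m}\<close>,
  where \<open>ord_idx\<close> returns a representative.\<close>

lemma sum_pivot_prob:
  assumes pos: "quota wt m > 0"
  shows "(\<Sum>i=1..m. pivot_prob M lam wt m i) = 1"
proof -
  let ?A = "\<lambda>i. {\<omega> \<in> space M. ord_idx lam m \<omega> (pivot_pos lam wt m \<omega>) = i}"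
  have m: "m \<in> {1..m}" using pos by (cases m) (auto simp: quota_def)
  have A: "?A i \<in> sets M" for i by (rule pivot_event_measurable) simp
  have "(\<Sum>i=1..m. pivot_prob M lam wt m i) = prob (\<Union>i\<in>{1..m}. ?A i)"
    unfolding pivot_prob_def
    by (rule finite_measure_finite_Union[symmetric]) (use A in \<open>auto simp: disjoint_family_on_def\<close>)
  also have "\<dots> = 1"
  proof (rule prob_eq_1[THEN iffD2])
    show "AE \<omega> in M. \<omega> \<in> (\<Union>i\<in>{1..m}. ?A i)"
      using AE_distinct[of m] AE_space
    proof eventually_elim
      case (elim \<omega>)
      have "pivot_pos lam wt m \<omega> \<in> {1..m}"
        using pivot_iff(2)[where lam=lam and \<omega>=\<omega> and wt=wt and m=m, OF elim(1) _ pos m] wt_nonneg by auto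
      then have "ord_idx lam m \<omega> (pivot_pos lam wt m \<omega>) \<in> {1..m}"
        using ord_idx_surj[where lam=lam and \<omega>=\<omega> and m=m, OF elim(1)] by metis
      then show ?case using elim by auto
    qed
  qed (use A in auto)
  finally show ?thesis .
qed

end

section \<open>Comparison of pivot probabilities\<close>

locale typed_assembly = prob_space M for M :: "'a measure" +
  fixes lam :: "nat \<Rightarrow> 'a \<Rightarrow> real" and r :: nat and \<tau> :: "nat \<Rightarrow> nat"
    and w :: "nat \<Rightarrow> real" and f :: "nat \<Rightarrow> real \<Rightarrow> real" and Med \<beta> :: real and m0 :: nat
  assumes tau_range: "\<And>k. k \<ge> 1 \<Longrightarrow> \<tau> k \<in> {1..r}"
    and w_nonneg: "\<And>\<theta>. \<theta> \<in> {1..r} \<Longrightarrow> w \<theta> \<ge> 0"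
    and f_meas [measurable]: "\<And>\<theta>. \<theta> \<in> {1..r} \<Longrightarrow> f \<theta> \<in> borel_measurable borel"
    and f_nonneg: "\<And>\<theta> x. \<theta> \<in> {1..r} \<Longrightarrow> f \<theta> x \<ge> 0"
    and f_density: "\<And>\<theta>. \<theta> \<in> {1..r} \<Longrightarrow> (\<integral>\<^sup>+ x. ennreal (f \<theta> x) \<partial>lborel) = 1"
    and indep: "indep_vars (\<lambda>_. borel) lam {1..}"
    and distr_lam: "\<And>k. k \<ge> 1 \<Longrightarrow> distributed M lborel (lam k) (\<lambda>x. ennreal (f (\<tau> k) x))"
    and \<beta>: "\<beta> > 0"
    and balanced: "\<And>m \<theta>. m \<ge> m0 \<Longrightarrow> m > 0 \<Longrightarrow> \<theta> \<in> {1..r} \<Longrightarrow> \<beta> * m \<le> card {k \<in> {1..m}. \<tau> k = \<theta>}"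
    and median: "\<And>\<theta>. \<theta> \<in> {1..r} \<Longrightarrow> measure (density lborel (\<lambda>x. ennreal (f \<theta> x))) {..Med} = 1/2"
    and f_Med_pos: "\<And>\<theta>. \<theta> \<in> {1..r} \<Longrightarrow> f \<theta> Med > 0"
    and f_cont: "\<And>\<theta>. \<theta> \<in> {1..r} \<Longrightarrow> isCont (f \<theta>) Med"
begin

abbreviation "wt k \<equiv> w (\<tau> k)"

sublocale assembly M lam wt "\<lambda>k. f (\<tau> k)"
  by unfold_locales (use tau_range w_nonneg f_meas f_nonneg indep distr_lam in auto)

section \<open>The laws of the types, near the median and far from it\<close>

abbreviation "law \<theta> \<equiv> density lborel (\<lambda>x. ennreal (f \<theta> x))"

lemma real_distribution_law: "\<theta> \<in> {1..r} \<Longrightarrow> real_distribution (law \<theta>)"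
proof -
  assume \<theta>: "\<theta> \<in> {1..r}"
  then have [measurable]: "f \<theta> \<in> borel_measurable borel" by (rule f_meas)
  have "emeasure (law \<theta>) (space (law \<theta>)) = 1"
    using f_density[OF \<theta>] by (subst emeasure_density) auto
  then have "prob_space (law \<theta>)" by (rule prob_spaceI)
  then show ?thesis by (simp add: real_distribution_def real_distribution_axioms_def)
qed

lemma law_singleton: "\<theta> \<in> {1..r} \<Longrightarrow> measure (law \<theta>) {x} = 0"
proof -
  assume "\<theta> \<in> {1..r}"
  then have [measurable]: "f \<theta> \<in> borel_measurable borel" by (rule f_meas)
  have "(\<integral>\<^sup>+y. ennreal (f \<theta> y) * indicator {x} y \<partial>lborel) = 0"
    by (subst nn_integral_0_iff_AE) (auto intro!: AE_I[where N="{x}"] simp: indicator_def)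
  then have "emeasure (law \<theta>) {x} = 0" by (subst emeasure_density) auto
  then show ?thesis by (simp add: measure_def)
qed

lemma cdf_Med: "\<theta> \<in> {1..r} \<Longrightarrow> cdf (law \<theta>) Med = 1/2"
  using median by (simp add: cdf_def)

lemma cdf_cont: "\<theta> \<in> {1..r} \<Longrightarrow> isCont (cdf (law \<theta>)) x"
proof -
  assume \<theta>: "\<theta> \<in> {1..r}"
  interpret L: real_distribution "law \<theta>" by (rule real_distribution_law[OF \<theta>])
  show ?thesis using law_singleton[OF \<theta>] by (simp add: L.isCont_cdf)
qed

lemma cdf_mono: "\<theta> \<in> {1..r} \<Longrightarrow> x \<le> y \<Longrightarrow> cdf (law \<theta>) x \<le> cdf (law \<theta>) y"
proof -
  assume \<theta>: "\<theta> \<in> {1..r}" and "x \<le> y"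
  interpret L: real_distribution "law \<theta>" by (rule real_distribution_law[OF \<theta>])
  show ?thesis using \<open>x \<le> y\<close> by (rule L.cdf_nondecreasing)
qed

lemma expectation_below:
  assumes "l \<ge> 1"
  shows "expectation (below lam x l) = cdf (law (\<tau> l)) x"
proof -
  have [measurable]: "lam l \<in> borel_measurable M" using assms by simp
  interpret L: real_distribution "law (\<tau> l)" using real_distribution_law tau_range[OF assms] .
  have "expectation (below lam x l) = expectation (indicator {\<omega> \<in> space M. lam l \<omega> < x})"
    unfolding below_def by (intro Bochner_Integration.integral_cong) auto
  also have "\<dots> = measure (distr M borel (lam l)) {..<x}"
    by (subst measure_distr) (auto intro!: arg_cong[where f=prob])
  also have "\<dots> = measure (law (\<tau> l)) {..<x}"
    by (simp add: distr_eq[OF assms])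
  \<comment> \<open>\<open>below\<close> compares strictly while \<open>cdf\<close> includes the end
    point; the added point is null.\<close>
  also have "\<dots> = measure (law (\<tau> l)) ({..<x} \<union> {x})"
    using law_singleton[OF tau_range[OF assms]] by (subst L.finite_measure_Union) auto
  also have "{..<x} \<union> {x} = {..x}" by auto
  finally show ?thesis by (simp add: cdf_def)
qed

text \<open>By continuity the density exceeds half of its positive value at \<open>Med\<close> in a
  neighbourhood. \<open>Med\<close> may be an end point of the interval, which gives a strict
  increase of the cdf on either side.\<close>

lemma law_interval_pos:
  assumes \<theta>: "\<theta> \<in> {1..r}" and ab: "a < b" "Med \<in> {a..b}"
  shows "cdf (law \<theta>) a < cdf (law \<theta>) b"
proof -
  interpret L: real_distribution "law \<theta>" by (rule real_distribution_law[OF \<theta>])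
  have [measurable]: "f \<theta> \<in> borel_measurable borel" using \<theta> by (rule f_meas)
  define c where "c = f \<theta> Med / 2"
  have c: "0 < c" "c < f \<theta> Med" using f_Med_pos[OF \<theta>] by (auto simp: c_def)
  have "\<forall>\<^sub>F x in at Med. c < f \<theta> x"
    using order_tendstoD(1)[OF f_cont[OF \<theta>, unfolded isCont_def] c(2)] .
  then obtain d where d: "d > 0" "\<And>x. \<bar>x - Med\<bar> < d \<Longrightarrow> c \<le> f \<theta> x"
  proof -
    from \<open>\<forall>\<^sub>F x in at Med. c < f \<theta> x\<close> obtain d where d: "d > 0" "\<forall>x. x \<noteq> Med \<and> dist x Med < d \<longrightarrow> c < f \<theta> x"
      unfolding eventually_at by auto
    have "c \<le> f \<theta> x" if "\<bar>x - Med\<bar> < d" for x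
      using d(2) c that by (cases "x = Med") (auto simp: dist_real_def less_imp_le)
    then show ?thesis using that d(1) by blast
  qed
  \<comment> \<open>Clipping at half the radius \<open>d\<close> keeps all points of the interval
    within distance \<open>d\<close> of \<open>Med\<close>, and the clipped interval stays
    nondegenerate even if \<open>Med\<close> is an end point.\<close>
  define a' b' where "a' = max a (Med - d/2)" and "b' = min b (Med + d/2)"
  have ab': "a' < b'" "a \<le> a'" "b' \<le> b" "\<And>x. x \<in> {a'<..b'} \<Longrightarrow> \<bar>x - Med\<bar> < d"
    using ab d(1) by (auto simp: a'_def b'_def)
  have "0 < ennreal (c * (b' - a'))" using c ab' by simp
  also have "ennreal (c * (b' - a')) = (\<integral>\<^sup>+x. ennreal c * indicator {a'<..b'} x \<partial>lborel)"
    using c ab' by (simp add: nn_integral_cmult_indicator ennreal_mult)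
  also have "\<dots> \<le> (\<integral>\<^sup>+x. ennreal (f \<theta> x) * indicator {a'<..b'} x \<partial>lborel)"
    using ab' d(2) by (intro nn_integral_mono) (auto simp: indicator_def intro!: ennreal_leI)
  also have "\<dots> = emeasure (law \<theta>) {a'<..b'}" by (subst emeasure_density) auto
  finally have "0 < measure (law \<theta>) {a'<..b'}" by (simp add: L.emeasure_eq_measure)
  also have "measure (law \<theta>) {a'<..b'} = cdf (law \<theta>) b' - cdf (law \<theta>) a'"
    using ab' by (subst L.cdf_diff_eq) auto
  finally show ?thesis using cdf_mono[OF \<theta> ab'(2)] cdf_mono[OF \<theta> ab'(3)] by linarith
qed

text \<open>The cdfs are strictly away from 1/2 at distance \<eta> from \<open>Med\<close> and
  monotone beyond. As there are finitely many types, one \<gamma> serves them all.\<close>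

lemma far_gap:
  assumes "\<eta> > 0"
  obtains \<gamma> where "0 < \<gamma>" "\<gamma> \<le> 1/2"
    "\<And>\<theta> x. \<theta> \<in> {1..r} \<Longrightarrow> x \<le> Med - \<eta> \<Longrightarrow> cdf (law \<theta>) x \<le> 1/2 - \<gamma>"
    "\<And>\<theta> x. \<theta> \<in> {1..r} \<Longrightarrow> x \<ge> Med + \<eta> \<Longrightarrow> 1/2 + \<gamma> \<le> cdf (law \<theta>) x"
proof -
  have "\<forall>\<^sub>F \<gamma> in at_right 0. cdf (law \<theta>) (Med - \<eta>) \<le> 1/2 - \<gamma> \<and> 1/2 + \<gamma> \<le> cdf (law \<theta>) (Med + \<eta>)"
    if \<theta>: "\<theta> \<in> {1..r}" for \<theta>
  proof -
    have "cdf (law \<theta>) (Med - \<eta>) < 1/2" "1/2 < cdf (law \<theta>) (Med + \<eta>)"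
      using law_interval_pos[OF \<theta>, of "Med - \<eta>" Med] law_interval_pos[OF \<theta>, of Med "Med + \<eta>"] assms
      by (auto simp: cdf_Med[OF \<theta>])
    then have "0 < min (1/2 - cdf (law \<theta>) (Med - \<eta>)) (cdf (law \<theta>) (Med + \<eta>) - 1/2)" by simp
    from eventually_at_right_less[of 0] eventually_at_right_real[OF this] show ?thesis
      by eventually_elim auto
  qed
  then have "\<forall>\<^sub>F \<gamma> in at_right 0. \<forall>\<theta>\<in>{1..r}. cdf (law \<theta>) (Med - \<eta>) \<le> 1/2 - \<gamma> \<and> 1/2 + \<gamma> \<le> cdf (law \<theta>) (Med + \<eta>)"
    by (intro eventually_ball_finite) auto
  moreover have "\<forall>\<^sub>F \<gamma> in at_right (0::real). \<gamma> \<in> {0<..<1/2}" by (rule eventually_at_right_real) simp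
  ultimately have "\<forall>\<^sub>F \<gamma> in at_right 0. \<gamma> \<in> {0<..<1/2} \<and>
     (\<forall>\<theta>\<in>{1..r}. cdf (law \<theta>) (Med - \<eta>) \<le> 1/2 - \<gamma> \<and> 1/2 + \<gamma> \<le> cdf (law \<theta>) (Med + \<eta>))"
    by (rule eventually_conj[rotated])
  from eventually_happens'[OF _ this] obtain \<gamma> where \<gamma>: "\<gamma> \<in> {0<..<1/2}"
     "\<forall>\<theta>\<in>{1..r}. cdf (law \<theta>) (Med - \<eta>) \<le> 1/2 - \<gamma> \<and> 1/2 + \<gamma> \<le> cdf (law \<theta>) (Med + \<eta>)"
    by (auto simp: trivial_limit_at_right_real)
  show ?thesis
  proof (rule that[of \<gamma>])
    fix \<theta> x assume \<theta>: "\<theta> \<in> {1..r}"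
    show "cdf (law \<theta>) x \<le> 1/2 - \<gamma>" if "x \<le> Med - \<eta>"
      using cdf_mono[OF \<theta> that] bspec[OF \<gamma>(2) \<theta>] by linarith
    show "1/2 + \<gamma> \<le> cdf (law \<theta>) x" if "x \<ge> Med + \<eta>"
      using cdf_mono[OF \<theta> that] bspec[OF \<gamma>(2) \<theta>] by linarith
  qed (use \<gamma> in auto)
qed

text \<open>All types lean to the same side of 1/2, so their contributions to the mean do not cancel
  and the mean is away from the quota by about 2\<gamma> times the quota, up to a bounded
  correction. Hitting the window then forces a deviation of at least \<epsilon>.\<close>

lemma window_far:
  assumes \<gamma>: "0 < \<gamma>" "\<gamma> \<le> 1/2"
    and x: "(\<forall>\<theta>\<in>{1..r}. cdf (law \<theta>) x \<le> 1/2 - \<gamma>) \<or> (\<forall>\<theta>\<in>{1..r}. 1/2 + \<gamma> \<le> cdf (law \<theta>) x)"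
    and W: "W > 0" "\<And>\<theta>. \<theta> \<in> {1..r} \<Longrightarrow> w \<theta> \<le> W"
    and i: "i \<in> {1..m}" "m \<ge> 2" and \<epsilon>: "\<epsilon> \<ge> 0" "\<epsilon> \<le> 2 * \<gamma> * quota wt m - W"
  shows "window m i x \<le> 2 * exp (-2 * \<epsilon>\<^sup>2 / (m * W\<^sup>2))"
proof -
  interpret B: bernoulli_family M "{1..m}" "below lam x" wt by (rule bernoulli_below)
  let ?D = "{1..m} - {i}"
  have D0: "?D \<noteq> {}"
  proof -
    have "card ?D = m - 1" using i by simp
    then show ?thesis using i by (metis One_nat_def Suc_1 card.empty diff_is_0_eq not_less_eq_eq)
  qed
  have wl: "0 \<le> wt l" "wt l \<le> W" if "l \<ge> 1" for l
    using w_nonneg W(2) tau_range[OF that] by auto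
  define S where "S = (\<Sum>l\<in>?D. wt l)"
  have S: "S = 2 * quota wt m - wt i"
    unfolding S_def quota_def using i by (simp add: sum_diff1)
  let ?\<mu> = "\<Sum>l\<in>?D. wt l * expectation (below lam x l)"
  have wi: "0 \<le> wt i" "wt i \<le> W" using wl i by auto
  \<comment> \<open>In both cases the distance from the mean to the nearer end of the window is at
    least 2\<gamma> times the quota minus \<open>wt i / 2 + \<gamma> * wt i\<close>, the loss from
    leaving out \<open>i\<close> and from the window length; \<open>W\<close> absorbs it.\<close>
  have "\<gamma> * wt i \<le> 1/2 * W" using \<gamma> wi by (intro mult_mono) auto
  then have gi: "wt i / 2 + \<gamma> * wt i \<le> W" using wi by simp
  have "{\<omega> \<in> space M. wsum wt (below lam x) ?D \<omega> \<in> {quota wt m - wt i<..quota wt m}}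
      \<subseteq> {\<omega> \<in> space M. \<bar>wsum wt (below lam x) ?D \<omega> - ?\<mu>\<bar> \<ge> \<epsilon>}"
  proof (cases "\<forall>\<theta>\<in>{1..r}. cdf (law \<theta>) x \<le> 1/2 - \<gamma>")
    case True
    have "?\<mu> \<le> (\<Sum>l\<in>?D. wt l * (1/2 - \<gamma>))"
      using True wl tau_range by (intro sum_mono mult_left_mono) (auto simp: expectation_below)
    also have "\<dots> = (1/2 - \<gamma>) * S" by (simp add: S_def sum_distrib_left mult.commute)
    finally have "?\<mu> \<le> (1/2 - \<gamma>) * (2 * quota wt m - wt i)" unfolding S .
    then have "?\<mu> + \<epsilon> \<le> quota wt m - wt i" using \<epsilon> gi by (simp add: algebra_simps)
    then show ?thesis by auto
  next
    case False
    then have "\<forall>\<theta>\<in>{1..r}. 1/2 + \<gamma> \<le> cdf (law \<theta>) x" using x by blast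
    then have "(\<Sum>l\<in>?D. wt l * (1/2 + \<gamma>)) \<le> ?\<mu>"
      using wl tau_range by (intro sum_mono mult_left_mono) (auto simp: expectation_below)
    moreover have "(\<Sum>l\<in>?D. wt l * (1/2 + \<gamma>)) = (1/2 + \<gamma>) * S"
      by (simp add: S_def sum_distrib_left mult.commute)
    ultimately have "(1/2 + \<gamma>) * (2 * quota wt m - wt i) \<le> ?\<mu>" unfolding S by simp
    then have "quota wt m + \<epsilon> \<le> ?\<mu>" using \<epsilon> gi by (simp add: algebra_simps)
    then show ?thesis by auto
  qed
  moreover have [measurable]: "wsum wt (below lam x) ?D \<in> borel_measurable M"
    by (rule B.wsum_measurable) auto
  ultimately have "window m i x \<le> prob {\<omega> \<in> space M. \<bar>wsum wt (below lam x) ?D \<omega> - ?\<mu>\<bar> \<ge> \<epsilon>}"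
    unfolding window_prob by (intro finite_measure_mono) auto
  also have "\<dots> \<le> 2 * exp (-2 * \<epsilon>\<^sup>2 / (card ?D * W\<^sup>2))"
    by (rule B.tail_weighted) (use D0 W wl \<epsilon> in auto)
  also have "\<dots> \<le> 2 * exp (-2 * \<epsilon>\<^sup>2 / (m * W\<^sup>2))"
  proof -
    have "real (card ?D) * W\<^sup>2 \<le> m * W\<^sup>2" using i by (intro mult_right_mono) auto
    moreover have "0 < real (card ?D) * W\<^sup>2" using D0 W by (simp add: card_gt_0_iff)
    ultimately have "2 * \<epsilon>\<^sup>2 / (m * W\<^sup>2) \<le> 2 * \<epsilon>\<^sup>2 / (card ?D * W\<^sup>2)"
      by (intro divide_left_mono) auto
    then show ?thesis by simp
  qed
  finally show ?thesis .
qed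

text \<open>Members of one type share the success probability, namely the cdf at \<open>x\<close>,
  so each type supplies a set to exchange within. Leaving out \<open>i\<close> and \<open>j\<close>
  costs at most two members, hence \<open>n + 2\<close>.\<close>

lemma window_near:
  fixes k l :: nat
  assumes ij: "i \<in> {1..m}" "j \<in> {1..m}" "i \<noteq> j"
    and w: "wt i > 0" "wt j > 0" "k * wt i \<le> l * wt j"
    and n: "0 < n" "n + 2 \<le> card {u \<in> {1..m}. \<tau> u = \<tau> i}" "n + 2 \<le> card {u \<in> {1..m}. \<tau> u = \<tau> j}"
    and \<delta>: "0 < \<delta>" "\<delta> \<le> 1/16"
    and x: "\<bar>cdf (law (\<tau> i)) x - 1/2\<bar> \<le> \<delta>" "\<bar>cdf (law (\<tau> j)) x - 1/2\<bar> \<le> \<delta>"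
  defines "\<kappa> \<equiv> ((1/2 + 2 * \<delta>) / (1/2 - 2 * \<delta>))\<^sup>2"
  shows "k * window m i x \<le> \<kappa> ^ (k + l + 2) * (l * window m j x
       + (l + k + real l ^ 2 + real k ^ 2) * (16 * exp (-2 * \<delta>\<^sup>2 * n)))"
proof -
  interpret B: bernoulli_family M "{1..m}" "below lam x" wt by (rule bernoulli_below)
  let ?T = "\<lambda>v. {u \<in> {1..m} - {i, j}. \<tau> u = \<tau> v}"
  have T: "n \<le> card (?T v)" if "n + 2 \<le> card {u \<in> {1..m}. \<tau> u = \<tau> v}" for v
  proof -
    have "card {u \<in> {1..m}. \<tau> u = \<tau> v} \<le> card (?T v \<union> {i, j})" by (intro card_mono) auto
    also have "\<dots> \<le> card (?T v) + card {i, j}" by (rule card_Un_le)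
    also have "\<dots> = card (?T v) + 2" using ij by simp
    finally show ?thesis using that by simp
  qed
  have g: "window m v x = expectation (\<lambda>\<omega>. indicator {quota wt m - wt v<..quota wt m} (wsum wt (below lam x) ({1..m} - {v}) \<omega>))" for v
    by (rule window_def)
  show ?thesis
    unfolding g \<kappa>_def
    by (rule B.near_compare[OF ij w, of "?T i" "cdf (law (\<tau> i)) x" "?T j" "cdf (law (\<tau> j)) x"])
       (use n T \<delta> x in \<open>auto simp: expectation_below\<close>)
qed

end

section \<open>Choice of constants and comparison of two types\<close>

text \<open>A rational l/k between a/b and K: k windows of length a then fit into l windows of
  length b, at a cost l/k still below K, even if a/b is irrational.\<close>

lemma obtain_fraction:
  fixes a b K :: real
  assumes "0 < a" "0 < b" "a / b < K"
  obtains k l :: nat where "k > 0" "k * a \<le> l * b" "l / k < K"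
proof -
  obtain q where q: "q \<in> \<rat>" "a / b < q" "q < K"
    using Rats_dense_in_real[OF assms(3)] by blast
  have "0 < a / b" using assms by simp
  then have "0 < q" using q by linarith
  then obtain l k :: nat where lk: "k \<noteq> 0" "\<bar>q\<bar> = real l / real k"
    using Rats_abs_nat_div_natE[OF q(1)] by metis
  then have q_eq: "q = l / k" and k: "k > 0" using \<open>0 < q\<close> by auto
  have "a \<le> q * b" using q(2) assms by (simp add: field_simps)
  then have "k * a \<le> k * (q * b)" by (intro mult_left_mono) auto
  also have "\<dots> = l * b" using k by (simp add: q_eq)
  finally show ?thesis using that[of k l] k q(3) q_eq by blast
qed

context typed_assembly
begin

text \<open>A single type of positive weight already makes the quota grow linearly, so the Hoeffding
  exponent far from the median is linear in m.\<close>

lemma quota_lower: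
  assumes m: "m \<ge> m0" "m > 0" and \<theta>: "\<theta> \<in> {1..r}"
  shows "w \<theta> * \<beta> * m \<le> 2 * quota wt m"
proof -
  have "w \<theta> * (\<beta> * m) \<le> w \<theta> * card {k \<in> {1..m}. \<tau> k = \<theta>}"
    using balanced[OF m \<theta>] w_nonneg[OF \<theta>] by (rule mult_left_mono)
  also have "\<dots> = (\<Sum>k\<in>{k \<in> {1..m}. \<tau> k = \<theta>}. wt k)" by simp
  also have "\<dots> \<le> (\<Sum>k\<in>{1..m}. wt k)"
  proof (rule sum_mono2)
    fix k assume "k \<in> {1..m} - {k \<in> {1..m}. \<tau> k = \<theta>}"
    then show "0 \<le> wt k" using w_nonneg[OF tau_range[of k]] by simp
  qed auto
  finally show ?thesis by (simp add: quota_def mult.assoc)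
qed

lemma integrable_f:
  assumes "\<theta> \<in> {1..r}"
  shows "integrable lborel (f \<theta>)" "(\<integral>x. f \<theta> x \<partial>lborel) = 1"
proof -
  have "f \<theta> \<in> borel_measurable lborel" using f_meas[OF assms] by simp
  then have "has_bochner_integral lborel (f \<theta>) 1"
    by (rule has_bochner_integral_nn_integral) (use f_nonneg[OF assms] f_density[OF assms] in auto)
  then show "integrable lborel (f \<theta>)" "(\<integral>x. f \<theta> x \<partial>lborel) = 1"
    by (auto simp: has_bochner_integral_iff)
qed

text \<open>The order of choice matters: \<open>N\<close> is fixed by the window counts, \<delta> is
  then small enough for the \<open>N\<close>-th power of the shift factor, and \<eta> follows from
  \<delta> by continuity of densities and cdfs at \<open>Med\<close>.\<close>

lemma near_constants:
  fixes N :: nat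
  assumes \<theta>: "\<theta> \<in> {1..r}" "\<theta>' \<in> {1..r}" and y: "y < K"
    and \<rho>: "f \<theta> Med / f \<theta>' Med < \<rho>"
  obtains \<delta> \<eta> where "0 < \<delta>" "\<delta> \<le> 1/16" "y * (((1/2 + 2 * \<delta>) / (1/2 - 2 * \<delta>))\<^sup>2) ^ N \<le> K" "0 < \<eta>"
    "\<And>x. \<bar>x - Med\<bar> < \<eta> \<Longrightarrow> f \<theta> x \<le> \<rho> * f \<theta>' x"
    "\<And>x. \<bar>x - Med\<bar> < \<eta> \<Longrightarrow> \<bar>cdf (law \<theta>) x - 1/2\<bar> \<le> \<delta>"
    "\<And>x. \<bar>x - Med\<bar> < \<eta> \<Longrightarrow> \<bar>cdf (law \<theta>') x - 1/2\<bar> \<le> \<delta>"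
proof -
  have "((\<lambda>\<delta>. y * (((1/2 + 2 * \<delta>) / (1/2 - 2 * \<delta>))\<^sup>2) ^ N) \<longlongrightarrow>
          y * (((1/2 + 2 * 0) / (1/2 - 2 * 0))\<^sup>2) ^ N) (at_right (0::real))"
    by (intro tendsto_intros) auto
  then have lim: "((\<lambda>\<delta>. y * (((1/2 + 2 * \<delta>) / (1/2 - 2 * \<delta>))\<^sup>2) ^ N) \<longlongrightarrow> y) (at_right (0::real))"
    by simp
  have "\<forall>\<^sub>F \<delta> in at_right (0::real). \<delta> \<in> {0<..<1/16}" by (rule eventually_at_right_real) simp
  with order_tendstoD(2)[OF lim y] have "\<forall>\<^sub>F \<delta> in at_right (0::real).
      y * (((1/2 + 2 * \<delta>) / (1/2 - 2 * \<delta>))\<^sup>2) ^ N < K \<and> \<delta> \<in> {0<..<1/16}"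
    by (rule eventually_conj)
  from eventually_happens'[OF _ this] obtain \<delta> where
    \<delta>: "y * (((1/2 + 2 * \<delta>) / (1/2 - 2 * \<delta>))\<^sup>2) ^ N < K" "0 < \<delta>" "\<delta> < 1/16"
    by (auto simp: trivial_limit_at_right_real)
  have f1: "(f \<theta> \<longlongrightarrow> f \<theta> Med) (nhds Med)" "(f \<theta>' \<longlongrightarrow> f \<theta>' Med) (nhds Med)"
    using f_cont \<theta> by (simp_all add: tendsto_nhds_iff isCont_def)
  have c1: "\<forall>\<^sub>F x in nhds Med. \<bar>cdf (law t) x - 1/2\<bar> < \<delta>" if "t \<in> {1..r}" for t
  proof -
    have "(cdf (law t) \<longlongrightarrow> cdf (law t) Med) (nhds Med)"
      using cdf_cont[OF that, of Med] by (simp add: tendsto_nhds_iff isCont_def)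
    from tendstoD[OF this \<delta>(2)] show ?thesis by (simp add: cdf_Med[OF that] dist_real_def)
  qed
  have "((\<lambda>x. \<rho> * f \<theta>' x - f \<theta> x) \<longlongrightarrow> \<rho> * f \<theta>' Med - f \<theta> Med) (nhds Med)"
    by (intro tendsto_intros f1)
  moreover have "0 < \<rho> * f \<theta>' Med - f \<theta> Med"
    using \<rho> f_Med_pos[OF \<theta>(2)] by (simp add: field_simps)
  ultimately have "\<forall>\<^sub>F x in nhds Med. 0 < \<rho> * f \<theta>' x - f \<theta> x" by (rule order_tendstoD(1))
  with c1[OF \<theta>(1)] c1[OF \<theta>(2)] have "\<forall>\<^sub>F x in nhds Med. f \<theta> x \<le> \<rho> * f \<theta>' x \<and>
     \<bar>cdf (law \<theta>) x - 1/2\<bar> \<le> \<delta> \<and> \<bar>cdf (law \<theta>') x - 1/2\<bar> \<le> \<delta>"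
    by eventually_elim auto
  then obtain \<eta> where "\<eta> > 0" "\<forall>x. dist x Med < \<eta> \<longrightarrow> f \<theta> x \<le> \<rho> * f \<theta>' x \<and>
     \<bar>cdf (law \<theta>) x - 1/2\<bar> \<le> \<delta> \<and> \<bar>cdf (law \<theta>') x - 1/2\<bar> \<le> \<delta>"
    unfolding eventually_nhds_metric by auto
  then show ?thesis using that[of \<delta> \<eta>] \<delta> by (auto simp: dist_real_def)
qed

text \<open>\<open>C\<close>, \<open>c\<close> and the threshold for m depend on the two types only;
  the bound holds for all pairs of these types at once, as the summation over all representatives
  requires.\<close>

lemma pivot_compare:
  assumes \<theta>: "\<theta> \<in> {1..r}" "\<theta>' \<in> {1..r}" and w: "w \<theta> > 0" "w \<theta>' > 0"
    and K: "(w \<theta> * f \<theta> Med) / (w \<theta>' * f \<theta>' Med) < K"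
  obtains C c :: real where "C \<ge> 0" "c > 0"
    "\<forall>\<^sub>F m in sequentially. \<forall>i\<in>{1..m}. \<forall>j\<in>{1..m}. i \<noteq> j \<longrightarrow> \<tau> i = \<theta> \<longrightarrow> \<tau> j = \<theta>' \<longrightarrow>
       pivot_prob M lam wt m i \<le> K * pivot_prob M lam wt m j + C * exp (- c * m)"
proof -
  define \<rho>0 where "\<rho>0 = f \<theta> Med / f \<theta>' Med"
  have \<rho>0: "\<rho>0 > 0" using f_Med_pos \<theta> by (simp add: \<rho>0_def)
  have "w \<theta> / w \<theta>' < K / \<rho>0"
  proof -
    have "w \<theta> / w \<theta>' = (w \<theta> * f \<theta> Med) / (w \<theta>' * f \<theta>' Med) / \<rho>0"
      using w f_Med_pos[OF \<theta>(1)] f_Med_pos[OF \<theta>(2)] by (simp add: \<rho>0_def)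
    also have "\<dots> < K / \<rho>0" using K \<rho>0 by (rule divide_strict_right_mono)
    finally show ?thesis .
  qed
  then obtain k l :: nat where kl: "k > 0" "k * w \<theta> \<le> l * w \<theta>'" "l / k < K / \<rho>0"
    by (rule obtain_fraction[OF w])
  have l: "l > 0"
  proof (rule ccontr)
    assume "\<not> l > 0"
    with kl w show False by (auto simp: mult_le_0_iff)
  qed
  have "\<rho>0 * l < K * k" using kl \<rho>0 by (simp add: field_simps)
  \<comment> \<open>Splits the slack in two: \<open>\<rho>0 * l < y\<close> leaves room for the
    variation of the density ratio near \<open>Med\<close>, and \<open>y < K * k\<close> leaves room
    for the powers of the shift factor.\<close>
  then obtain y where y: "\<rho>0 * l < y" "y < K * k" using dense by blast
  define \<rho> where "\<rho> = y / l"
  have \<rho>: "f \<theta> Med / f \<theta>' Med < \<rho>" using y l by (simp add: \<rho>_def \<rho>0_def[symmetric] field_simps)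
  from near_constants[OF \<theta> y(2) \<rho>, of "k + l + 2"] obtain \<delta> \<eta> where
    \<delta>: "0 < \<delta>" "\<delta> \<le> 1/16" "y * (((1/2 + 2 * \<delta>) / (1/2 - 2 * \<delta>))\<^sup>2) ^ (k + l + 2) \<le> K * k" and
    \<eta>: "0 < \<eta>" "\<And>x. \<bar>x - Med\<bar> < \<eta> \<Longrightarrow> f \<theta> x \<le> \<rho> * f \<theta>' x"
    "\<And>x. \<bar>x - Med\<bar> < \<eta> \<Longrightarrow> \<bar>cdf (law \<theta>) x - 1/2\<bar> \<le> \<delta>"
    "\<And>x. \<bar>x - Med\<bar> < \<eta> \<Longrightarrow> \<bar>cdf (law \<theta>') x - 1/2\<bar> \<le> \<delta>"
    by blast
  define \<kappa> where "\<kappa> = (((1/2 + 2 * \<delta>) / (1/2 - 2 * \<delta>))\<^sup>2) ^ (k + l + 2)"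
  have \<kappa>: "1 \<le> \<kappa>"
    unfolding \<kappa>_def using \<delta> by (intro one_le_power) (simp add: field_simps)
  from far_gap[OF \<eta>(1)] obtain \<gamma> where \<gamma>: "0 < \<gamma>" "\<gamma> \<le> 1/2"
    "\<And>t x. t \<in> {1..r} \<Longrightarrow> x \<le> Med - \<eta> \<Longrightarrow> cdf (law t) x \<le> 1/2 - \<gamma>"
    "\<And>t x. t \<in> {1..r} \<Longrightarrow> x \<ge> Med + \<eta> \<Longrightarrow> 1/2 + \<gamma> \<le> cdf (law t) x" by blast
  define W where "W = (\<Sum>t\<in>{1..r}. w t)"
  have W: "w t \<le> W" if "t \<in> {1..r}" for t
    unfolding W_def using that w_nonneg by (intro member_le_sum) auto
  have W0: "W > 0" using W[OF \<theta>(1)] w by simp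
  define \<alpha> where "\<alpha> = \<gamma> * w \<theta>' * \<beta>"
  have \<alpha>: "\<alpha> > 0" using \<gamma> w \<beta> by (simp add: \<alpha>_def)
  \<comment> \<open>The smaller of two rates: near the median the exponent is 2 \<delta>^2 n with n
    \<ge> \<beta> m / 2, far from it Hoeffding is applied with deviation \<alpha> m / 2.\<close>
  define c where "c = min (\<delta>\<^sup>2 * \<beta>) (\<alpha>\<^sup>2 / (2 * W\<^sup>2))"
  have c: "c > 0" using \<delta> \<beta> \<alpha> W0 by (simp add: c_def)
  define R where "R = l + k + real l ^ 2 + real k ^ 2"
  have R: "R \<ge> 0" by (simp add: R_def)
  \<comment> \<open>The first summand collects the errors of the window comparison near the median,
    the second the far bound \<open>2 * e\<close> taken \<open>k\<close> times.\<close>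
  define C where "C = \<kappa> * R * 16 + 2 * k"
  have C: "C \<ge> 0" using R \<kappa> by (simp add: C_def)
  have main: "pivot_prob M lam wt m i \<le> K * pivot_prob M lam wt m j + C * exp (- c * m)"
    if m: "m \<ge> m0" "m \<ge> 2" "\<beta> * m \<ge> 8" "\<alpha> * m \<ge> 2 * W" and ij: "i \<in> {1..m}" "j \<in> {1..m}" "i \<noteq> j"
      and \<tau>: "\<tau> i = \<theta>" "\<tau> j = \<theta>'" for m i j
  proof -
    define e where "e = exp (- c * m)"
    have e: "e > 0" by (simp add: e_def)
    have "0 < w \<theta>' * \<beta> * m" using w \<beta> m by simp
    then have q: "quota wt m > 0" using quota_lower[OF m(1) _ \<theta>(2)] m by linarith
    have far: "window m i x \<le> 2 * e" if x: "\<bar>x - Med\<bar> \<ge> \<eta>" for x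
    proof -
      have "\<gamma> * (w \<theta>' * \<beta> * m) \<le> \<gamma> * (2 * quota wt m)"
        using quota_lower[OF m(1) _ \<theta>(2)] m \<gamma> by (intro mult_left_mono) auto
      then have le: "\<alpha> * m / 2 \<le> 2 * \<gamma> * quota wt m - W"
        using m(4) by (simp add: \<alpha>_def mult_ac)
      have "window m i x \<le> 2 * exp (-2 * (\<alpha> * m / 2)\<^sup>2 / (m * W\<^sup>2))"
      proof (rule window_far[OF \<gamma>(1,2) _ W0 W ij(1) m(2) _ le])
        show "(\<forall>t\<in>{1..r}. cdf (law t) x \<le> 1/2 - \<gamma>) \<or> (\<forall>t\<in>{1..r}. 1/2 + \<gamma> \<le> cdf (law t) x)"
        proof (cases "x \<le> Med - \<eta>")
          case True
          then show ?thesis using \<gamma>(3) by blast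
        next
          case False
          then have "x \<ge> Med + \<eta>" using x by linarith
          then show ?thesis using \<gamma>(4) by blast
        qed
      qed (use \<alpha> in auto)
      also have "-2 * (\<alpha> * m / 2)\<^sup>2 / (m * W\<^sup>2) = - (\<alpha>\<^sup>2 / (2 * W\<^sup>2)) * m"
        using m W0 by (simp add: power2_eq_square field_simps)
      also have "2 * exp (- (\<alpha>\<^sup>2 / (2 * W\<^sup>2)) * m) \<le> 2 * e"
      proof -
        have "c * m \<le> \<alpha>\<^sup>2 / (2 * W\<^sup>2) * m" by (intro mult_right_mono) (auto simp: c_def)
        then show ?thesis by (simp add: e_def)
      qed
      finally show ?thesis .
    qed
    \<comment> \<open>The 2 accounts for leaving out \<open>i\<close> and \<open>j\<close>;
      \<open>\<beta> * m \<ge> 8\<close> keeps n positive and at least half of \<beta> m.\<close>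
    define n where "n = min (card {u \<in> {1..m}. \<tau> u = \<theta>}) (card {u \<in> {1..m}. \<tau> u = \<theta>'}) - 2"
    have cards: "\<beta> * m \<le> card {u \<in> {1..m}. \<tau> u = \<theta>}" "\<beta> * m \<le> card {u \<in> {1..m}. \<tau> u = \<theta>'}"
      using balanced[OF m(1) _ \<theta>(1)] balanced[OF m(1) _ \<theta>(2)] m by auto
    have n: "0 < n" "n + 2 \<le> card {u \<in> {1..m}. \<tau> u = \<theta>}" "n + 2 \<le> card {u \<in> {1..m}. \<tau> u = \<theta>'}"
       "\<beta> * m / 2 \<le> n"
      using cards m(3) by (auto simp: n_def min_def)
    have en: "exp (-2 * \<delta>\<^sup>2 * n) \<le> e"
    proof -
      have "c * m \<le> \<delta>\<^sup>2 * \<beta> * m" by (intro mult_right_mono) (auto simp: c_def)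
      also have "\<dots> = 2 * \<delta>\<^sup>2 * (\<beta> * m / 2)" by simp
      also have "\<dots> \<le> 2 * \<delta>\<^sup>2 * n" using n(4) by (intro mult_left_mono) auto
      finally show ?thesis by (simp add: e_def)
    qed
    \<comment> \<open>The error carries the factor \<open>f \<theta> x\<close>, so over the whole
      line it integrates to \<open>C * e\<close>. This lets the near and far regions be treated by
      one pointwise bound.\<close>
    have point: "k * (f \<theta> x * window m i x) \<le> K * k * (f \<theta>' x * window m j x) + C * e * f \<theta> x" for x
    proof (cases "\<bar>x - Med\<bar> < \<eta>")
      case True
      have fx: "0 \<le> f \<theta> x" "0 \<le> f \<theta>' x" using f_nonneg \<theta> by auto
      have wj: "0 \<le> window m j x" by (rule window_01)
      have "k * window m i x \<le> \<kappa> * (l * window m j x + R * (16 * exp (-2 * \<delta>\<^sup>2 * n)))"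
        unfolding \<kappa>_def R_def
        by (rule window_near[OF ij]) (use w kl n \<delta> \<eta>(3,4)[OF True] in \<open>auto simp: \<tau>\<close>)
      also have "\<dots> \<le> \<kappa> * (l * window m j x + R * (16 * e))"
        using en \<kappa> R by (intro mult_left_mono add_left_mono) auto
      also have "\<dots> \<le> \<kappa> * l * window m j x + C * e"
        using e by (simp add: C_def algebra_simps)
      finally have "f \<theta> x * (k * window m i x) \<le> f \<theta> x * (\<kappa> * l * window m j x + C * e)"
        using fx(1) by (rule mult_left_mono)
      also have "\<dots> = f \<theta> x * (\<kappa> * l * window m j x) + C * e * f \<theta> x" by (simp add: algebra_simps)
      also have "f \<theta> x * (\<kappa> * l * window m j x) \<le> (\<rho> * f \<theta>' x) * (\<kappa> * l * window m j x)"
        using \<eta>(2)[OF True] \<kappa> wj by (intro mult_right_mono) auto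
      also have "\<dots> = (y * \<kappa>) * (f \<theta>' x * window m j x)" using l by (simp add: \<rho>_def)
      also have "\<dots> \<le> (K * k) * (f \<theta>' x * window m j x)"
        using \<delta>(3) fx wj by (intro mult_right_mono) (auto simp: \<kappa>_def)
      finally show ?thesis by (simp add: algebra_simps)
    next
      case False
      have fx: "0 \<le> f \<theta> x" "0 \<le> f \<theta>' x" using f_nonneg \<theta> by auto
      have "0 \<le> K"
        using K w f_Med_pos[OF \<theta>(1)] f_Med_pos[OF \<theta>(2)]
        by (smt (verit) divide_pos_pos mult_pos_pos)
      then have 0: "0 \<le> K * k * (f \<theta>' x * window m j x)" using fx window_01(1)[of m j x] by simp
      have "k * (f \<theta> x * window m i x) \<le> k * (f \<theta> x * (2 * e))"
        using far[of x] False fx by (intro mult_left_mono) auto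
      also have "\<dots> \<le> C * e * f \<theta> x"
      proof -
        have "2 * k * (e * f \<theta> x) \<le> C * (e * f \<theta> x)"
          using fx e R \<kappa> by (intro mult_right_mono) (auto simp: C_def)
        then show ?thesis by (simp add: algebra_simps)
      qed
      finally show ?thesis using 0 by linarith
    qed
    note I = pivot_prob_eq_window[OF q ij(1), unfolded \<tau>] pivot_prob_eq_window[OF q ij(2), unfolded \<tau>]
    have "k * pivot_prob M lam wt m i = (\<integral>x. k * (f \<theta> x * window m i x) \<partial>lborel)"
      unfolding I(1) by simp
    also have "\<dots> \<le> (\<integral>x. K * k * (f \<theta>' x * window m j x) + C * e * f \<theta> x \<partial>lborel)"
      by (rule integral_mono) (use I integrable_f[OF \<theta>(1)] point in auto)
    also have "\<dots> = (\<integral>x. K * k * (f \<theta>' x * window m j x) \<partial>lborel) + (\<integral>x. C * e * f \<theta> x \<partial>lborel)"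
      by (rule Bochner_Integration.integral_add) (use I integrable_f[OF \<theta>(1)] in auto)
    also have "\<dots> = K * k * pivot_prob M lam wt m j + C * e"
      unfolding I(3) by (simp add: integrable_f[OF \<theta>(1)])
    also have "\<dots> \<le> K * k * pivot_prob M lam wt m j + k * (C * e)"
    proof -
      have "1 * (C * e) \<le> k * (C * e)" using kl(1) C e by (intro mult_right_mono) auto
      then show ?thesis by simp
    qed
    finally have "k * pivot_prob M lam wt m i \<le> k * (K * pivot_prob M lam wt m j + C * e)"
      by (simp add: algebra_simps)
    then show ?thesis using kl(1) by (simp add: e_def)
  qed
  have ev: "\<forall>\<^sub>F m in sequentially. z \<le> b * real m" if "b > 0" for z b :: real
    using that by real_asymp
  have "\<forall>\<^sub>F m in sequentially. \<forall>i\<in>{1..m}. \<forall>j\<in>{1..m}. i \<noteq> j \<longrightarrow> \<tau> i = \<theta> \<longrightarrow> \<tau> j = \<theta>' \<longrightarrow>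
       pivot_prob M lam wt m i \<le> K * pivot_prob M lam wt m j + C * exp (- c * m)"
    using eventually_ge_at_top[of m0] eventually_ge_at_top[of 2] ev[OF \<beta>, of 8] ev[OF \<alpha>, of "2 * W"]
    by eventually_elim (use main in blast)
  from that[OF C c this] show ?thesis .
qed

section \<open>The lower bound of order 1/m and the limit\<close>

lemma pivot_prob_weight_0:
  assumes "i \<in> {1..m}" "wt i = 0" "quota wt m > 0"
  shows "pivot_prob M lam wt m i = 0"
  using pivot_prob_eq_window(1)[OF assms(3,1)] assms(2) by (simp add: window_def)

lemma quota_pos:
  assumes "j \<in> {1..m}" "wt j > 0"
  shows "quota wt m > 0"
proof -
  have "wt j \<le> (\<Sum>k=1..m. wt k)"
    using assms w_nonneg tau_range by (intro member_le_sum) auto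
  then show ?thesis using assms by (simp add: quota_def)
qed

text \<open>Every representative's probability is bounded by a constant multiple of that of
  \<open>j\<close> plus 1/(2m). The m error terms add up to 1/2, so the total mass 1 forces the
  probability of \<open>j\<close> to be at least of order 1/m. Types of weight 0 have probability
  0.\<close>

lemma pivot_prob_lower:
  assumes j: "j \<ge> 1" "wt j > 0"
  obtains c where "c > 0" "\<forall>\<^sub>F m in sequentially. c / m \<le> pivot_prob M lam wt m j"
proof -
  have "\<exists>K\<ge>1. \<forall>\<^sub>F m in sequentially. \<forall>i\<in>{1..m}. \<tau> i = \<theta> \<longrightarrow>
      pivot_prob M lam wt m i \<le> K * pivot_prob M lam wt m j + 1 / (2 * m)" if \<theta>: "\<theta> \<in> {1..r}" for \<theta>
  proof (cases "w \<theta> > 0")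
    case True
    \<comment> \<open>Adding 1 gives the strict inequality that the comparison asks for, and K \<ge>
      1, which covers the representative \<open>j\<close> itself.\<close>
    define K where "K = (w \<theta> * f \<theta> Med) / (wt j * f (\<tau> j) Med) + 1"
    have K1: "K \<ge> 1"
      using True f_Med_pos[OF \<theta>] f_Med_pos[OF tau_range[OF j(1)]] j(2) by (simp add: K_def)
    obtain C c :: real where C: "C \<ge> 0" "c > 0"
      and ev: "\<forall>\<^sub>F m in sequentially. \<forall>i\<in>{1..m}. \<forall>j'\<in>{1..m}. i \<noteq> j' \<longrightarrow> \<tau> i = \<theta> \<longrightarrow> \<tau> j' = \<tau> j \<longrightarrow>
       pivot_prob M lam wt m i \<le> K * pivot_prob M lam wt m j' + C * exp (- c * m)"
      using pivot_compare[OF \<theta> tau_range[OF j(1)] True j(2), of K] by (auto simp: K_def)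
    have ex: "\<forall>\<^sub>F m in sequentially. C * exp (- c * real m) \<le> 1 / (2 * real m)"
    proof (cases "C = 0")
      case False
      with C have "C > 0" by simp
      with C(2) show ?thesis by real_asymp
    qed simp
    have "\<forall>\<^sub>F m in sequentially. \<forall>i\<in>{1..m}. \<tau> i = \<theta> \<longrightarrow>
      pivot_prob M lam wt m i \<le> K * pivot_prob M lam wt m j + 1 / (2 * m)"
      using ev ex eventually_ge_at_top[of j]
    proof eventually_elim
      case (elim m)
      show ?case
      proof (intro ballI impI)
        fix i assume i: "i \<in> {1..m}" "\<tau> i = \<theta>"
        show "pivot_prob M lam wt m i \<le> K * pivot_prob M lam wt m j + 1 / (2 * m)"
        proof (cases "i = j")
          case True
          have "0 \<le> pivot_prob M lam wt m j" by (simp add: pivot_prob_def)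
          then have "1 * pivot_prob M lam wt m j \<le> K * pivot_prob M lam wt m j"
            using K1 by (intro mult_right_mono)
          then show ?thesis using True by (simp add: add_increasing2)
        next
          case False
          have "j \<in> {1..m}" using j elim by simp
          then show ?thesis using elim i False by fastforce
        qed
      qed
    qed
    with K1 show ?thesis by blast
  next
    case False
    then have w0: "w \<theta> = 0" using w_nonneg[OF \<theta>] by simp
    have "\<forall>\<^sub>F m in sequentially. \<forall>i\<in>{1..m}. \<tau> i = \<theta> \<longrightarrow>
      pivot_prob M lam wt m i \<le> 1 * pivot_prob M lam wt m j + 1 / (2 * m)"
      using eventually_ge_at_top[of j]
    proof eventually_elim
      case (elim m)
      then have "quota wt m > 0" using quota_pos[of j m] j by simp
      then show ?case using pivot_prob_weight_0 w0 by (auto simp: pivot_prob_def)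
    qed
    then show ?thesis by blast
  qed
  then have "\<forall>\<theta>\<in>{1..r}. \<exists>K\<ge>1. \<forall>\<^sub>F m in sequentially. \<forall>i\<in>{1..m}. \<tau> i = \<theta> \<longrightarrow>
      pivot_prob M lam wt m i \<le> K * pivot_prob M lam wt m j + 1 / (2 * m)" by blast
  from bchoice[OF this] obtain K where K: "\<And>\<theta>. \<theta> \<in> {1..r} \<Longrightarrow> K \<theta> \<ge> (1::real)"
    "\<And>\<theta>. \<theta> \<in> {1..r} \<Longrightarrow> \<forall>\<^sub>F m in sequentially. \<forall>i\<in>{1..m}. \<tau> i = \<theta> \<longrightarrow>
      pivot_prob M lam wt m i \<le> K \<theta> * pivot_prob M lam wt m j + 1 / (2 * m)"
    by blast
  define L where "L = (\<Sum>\<theta>\<in>{1..r}. K \<theta>)"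
  have L: "K \<theta> \<le> L" if "\<theta> \<in> {1..r}" for \<theta>
    unfolding L_def using that K(1) by (intro member_le_sum) (auto intro: order_trans[of 0 1])
  have L0: "L > 0" using L[OF tau_range[OF j(1)]] K(1)[OF tau_range[OF j(1)]] by simp
  have all: "\<forall>\<^sub>F m in sequentially. \<forall>\<theta>\<in>{1..r}. \<forall>i\<in>{1..m}. \<tau> i = \<theta> \<longrightarrow>
      pivot_prob M lam wt m i \<le> K \<theta> * pivot_prob M lam wt m j + 1 / (2 * m)"
    using K(2) by (intro eventually_ball_finite) auto
  have "\<forall>\<^sub>F m in sequentially. (1 / (2 * L)) / m \<le> pivot_prob M lam wt m j"
    using all eventually_ge_at_top[of j]
  proof eventually_elim
    case (elim m)
    have m: "m > 0" using elim j by simp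
    have p: "0 \<le> pivot_prob M lam wt m j" by (simp add: pivot_prob_def)
    have "quota wt m > 0" using quota_pos[of j m] j elim by simp
    then have "1 = (\<Sum>i=1..m. pivot_prob M lam wt m i)" using sum_pivot_prob by simp
    also have "\<dots> \<le> (\<Sum>i=1..m. L * pivot_prob M lam wt m j + 1 / (2 * m))"
    proof (rule sum_mono)
      fix i assume i: "i \<in> {1..m}"
      then have \<tau>: "\<tau> i \<in> {1..r}" using tau_range by simp
      have "pivot_prob M lam wt m i \<le> K (\<tau> i) * pivot_prob M lam wt m j + 1 / (2 * m)"
        using elim(1) \<tau> i by blast
      also have "\<dots> \<le> L * pivot_prob M lam wt m j + 1 / (2 * m)"
        using L[OF \<tau>] p by (intro add_right_mono mult_right_mono)
      finally show "pivot_prob M lam wt m i \<le> L * pivot_prob M lam wt m j + 1 / (2 * m)" .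
    qed
    also have "\<dots> = m * L * pivot_prob M lam wt m j + 1 / 2"
      using m by (simp add: algebra_simps)
    finally have "1 / 2 \<le> m * L * pivot_prob M lam wt m j" by simp
    then show ?case using m L0 by (simp add: field_simps)
  qed
  with L0 show ?thesis by (intro that[of "1 / (2 * L)"]) auto
qed

text \<open>A \<open>K'\<close> strictly between the limit ratio and \<open>K\<close> leaves room (K
  - K') times the probability of \<open>j\<close>, which is of order at least 1/m and dominates the
  exponential error. Positivity is part of the claim so that quotients can be inverted
  later.\<close>

lemma ratio_upper:
  assumes i: "i \<ge> 1" "wt i > 0" and j: "j \<ge> 1" "wt j > 0"
    and K: "(wt i * f (\<tau> i) Med) / (wt j * f (\<tau> j) Med) < K"
  shows "\<forall>\<^sub>F m in sequentially. 0 < pivot_prob M lam wt m j \<and>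
     pivot_prob M lam wt m i / pivot_prob M lam wt m j < K"
proof -
  note \<tau> = tau_range[OF i(1)] tau_range[OF j(1)]
  obtain b where b: "b > 0" "\<forall>\<^sub>F m in sequentially. b / m \<le> pivot_prob M lam wt m j"
    using pivot_prob_lower[OF j] .
  obtain K' where K': "(wt i * f (\<tau> i) Med) / (wt j * f (\<tau> j) Med) < K'" "K' < K"
    using dense[OF K] by blast
  obtain C c :: real where C: "C \<ge> 0" "c > 0"
    and ev: "\<forall>\<^sub>F m in sequentially. \<forall>i'\<in>{1..m}. \<forall>j'\<in>{1..m}. i' \<noteq> j' \<longrightarrow> \<tau> i' = \<tau> i \<longrightarrow> \<tau> j' = \<tau> j \<longrightarrow>
       pivot_prob M lam wt m i' \<le> K' * pivot_prob M lam wt m j' + C * exp (- c * m)"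
    using pivot_compare[OF \<tau> i(2) j(2) K'(1)] .
  have ex: "\<forall>\<^sub>F m in sequentially. C * exp (- c * real m) < (K - K') * (b / real m)"
  proof (cases "C = 0")
    case True
    then show ?thesis using b(1) K' by (intro eventually_mono[OF eventually_gt_at_top[of 0]]) simp
  next
    case False
    with C have "C > 0" by simp
    moreover have "K - K' > 0" using K' by simp
    ultimately show ?thesis using C(2) b(1) by real_asymp
  qed
  show ?thesis
    using ev ex b(2) eventually_ge_at_top[of i] eventually_ge_at_top[of j]
  proof eventually_elim
    case (elim m)
    have m: "i \<in> {1..m}" "j \<in> {1..m}" "m > 0" using elim i j by auto
    have pos: "0 < pivot_prob M lam wt m j"
      using elim(3) b m by (smt (verit) divide_pos_pos of_nat_0_less_iff)
    have "pivot_prob M lam wt m i < K * pivot_prob M lam wt m j"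
    proof (cases "i = j")
      case True
      have "wt j \<noteq> 0" "f (\<tau> j) Med \<noteq> 0" using j f_Med_pos[OF \<tau>(2)] by auto
      then have "1 < K" using K True by simp
      then show ?thesis using True pos by simp
    next
      case False
      then have "pivot_prob M lam wt m i \<le> K' * pivot_prob M lam wt m j + C * exp (- c * m)"
        using elim(1) m by blast
      also have "\<dots> < K' * pivot_prob M lam wt m j + (K - K') * (b / m)" using elim(2) by simp
      also have "\<dots> \<le> K' * pivot_prob M lam wt m j + (K - K') * pivot_prob M lam wt m j"
        using elim(3) K' by (intro add_left_mono mult_left_mono) auto
      finally show ?thesis by (simp add: algebra_simps)
    qed
    then show ?case using pos by (simp add: field_simps)
  qed
qed

text \<open>For positive weights the upper bound is applied to (i, j) and, through reciprocals, to
  (j, i). If \<open>i\<close> has weight 0, the quotient is eventually 0, as is the limit.\<close>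

lemma ratio_limit:
  assumes i: "i \<ge> 1" and j: "j \<ge> 1" "wt j > 0"
  shows "(\<lambda>m. pivot_prob M lam wt m i / pivot_prob M lam wt m j)
    \<longlonglongrightarrow> (wt i * f (\<tau> i) Med) / (wt j * f (\<tau> j) Med)"
proof (cases "wt i > 0")
  case False
  then have w0: "wt i = 0" using w_nonneg[OF tau_range[OF i]] by simp
  have "\<forall>\<^sub>F m in sequentially. pivot_prob M lam wt m i / pivot_prob M lam wt m j = 0"
    using eventually_ge_at_top[of i] eventually_ge_at_top[of j]
  proof eventually_elim
    case (elim m)
    then have "quota wt m > 0" using quota_pos[of j m] j by simp
    then show ?case using pivot_prob_weight_0[of i m] w0 elim i by simp
  qed
  then show ?thesis using w0 by (simp add: tendsto_eventually)
next
  case True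
  let ?R = "(wt i * f (\<tau> i) Med) / (wt j * f (\<tau> j) Med)"
  have fpos: "f (\<tau> i) Med > 0" "f (\<tau> j) Med > 0" using f_Med_pos tau_range i j by auto
  have Rpos: "?R > 0" using True j fpos by simp
  show ?thesis
  proof (rule order_tendstoI)
    fix K assume "?R < K"
    from ratio_upper[OF i True j this]
    show "\<forall>\<^sub>F m in sequentially. pivot_prob M lam wt m i / pivot_prob M lam wt m j < K"
      by eventually_elim simp
  next
    fix K assume K: "K < ?R"
    \<comment> \<open>\<open>K\<close> may be nonpositive; raising it to at least half of the limit
      allows taking reciprocals.\<close>
    define K' where "K' = max K (?R / 2)"
    have K': "0 < K'" "K' < ?R" "K \<le> K'" using K Rpos by (auto simp: K'_def)
    have "(wt j * f (\<tau> j) Med) / (wt i * f (\<tau> i) Med) < 1 / K'"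
      using K' True j fpos by (simp add: field_simps)
    \<comment> \<open>The exchanged bound gives positivity for \<open>i\<close> only; the second
      instance, with the arbitrary bound \<open>?R + 1\<close>, supplies it for
      \<open>j\<close>.\<close>
    from ratio_upper[OF j i True this] ratio_upper[OF i True j, of "?R + 1", OF less_add_one]
    show "\<forall>\<^sub>F m in sequentially. K < pivot_prob M lam wt m i / pivot_prob M lam wt m j"
    proof eventually_elim
      case (elim m)
      then have "0 < pivot_prob M lam wt m i" "0 < pivot_prob M lam wt m j"
        "pivot_prob M lam wt m j / pivot_prob M lam wt m i < 1 / K'" by auto
      then have "K' < pivot_prob M lam wt m i / pivot_prob M lam wt m j"
        using K'(1) by (simp add: field_simps)
      then show ?case using K'(3) by simp
    qed
  qed
qed

end

theorem theorem1:
  fixes M :: "'a measure"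
    and lam :: "nat \<Rightarrow> 'a \<Rightarrow> real"
    and r :: nat
    and \<tau> :: "nat \<Rightarrow> nat"
    and w :: "nat \<Rightarrow> real"
    and f :: "nat \<Rightarrow> real \<Rightarrow> real"
    and Med :: real
    and i j :: nat
  assumes "prob_space M"
    and tau_range: "\<forall>k\<ge>1. \<tau> k \<in> {1..r}"
    and w_nonneg: "\<forall>\<theta>\<in>{1..r}. w \<theta> \<ge> 0"
    and f_meas: "\<forall>\<theta>\<in>{1..r}. f \<theta> \<in> borel_measurable lborel"
    and f_nonneg: "\<forall>\<theta>\<in>{1..r}. \<forall>x. f \<theta> x \<ge> 0"
    and f_density: "\<forall>\<theta>\<in>{1..r}. (\<integral>\<^sup>+ x. ennreal (f \<theta> x) \<partial>lborel) = 1"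
    and indep: "prob_space.indep_vars M (\<lambda>_. borel) lam {1..}"
    and distr: "\<forall>k\<ge>1. distributed M lborel (lam k) (\<lambda>x. ennreal (f (\<tau> k) x))"
    and balanced: "\<exists>\<beta>>0. \<exists>m0. \<forall>m\<ge>m0. \<forall>\<theta>\<in>{1..r}.
                     real (card {k \<in> {1..m}. \<tau> k = \<theta>}) / real m \<ge> \<beta>"
    and median: "\<forall>\<theta>\<in>{1..r}. measure (density lborel (\<lambda>x. ennreal (f \<theta> x))) {..Med} = 1/2"
    and f_Med_pos: "\<forall>\<theta>\<in>{1..r}. f \<theta> Med > 0"
    and f_local: "\<exists>\<epsilon>1>0. \<exists>c\<ge>0. \<forall>\<theta>\<in>{1..r}. \<forall>x\<in>{Med - \<epsilon>1..Med + \<epsilon>1}.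
                     \<bar>f \<theta> x - f \<theta> Med\<bar> \<le> c * (x - Med)\<^sup>2"
    and "i \<ge> 1" and "j \<ge> 1"
    and wj_pos: "w (\<tau> j) > 0"
  shows "(\<lambda>m. pivot_prob M lam (\<lambda>k. w (\<tau> k)) m i / pivot_prob M lam (\<lambda>k. w (\<tau> k)) m j)
           \<longlonglongrightarrow> (w (\<tau> i) * f (\<tau> i) Med) / (w (\<tau> j) * f (\<tau> j) Med)"
proof -
  obtain \<beta> m0 where \<beta>: "\<beta> > 0" "\<forall>m\<ge>m0. \<forall>\<theta>\<in>{1..r}. real (card {k \<in> {1..m}. \<tau> k = \<theta>}) / real m \<ge> \<beta>"
    using balanced by blast
  obtain \<epsilon> c where \<epsilon>: "\<epsilon> > 0" "\<forall>\<theta>\<in>{1..r}. \<forall>x\<in>{Med - \<epsilon>..Med + \<epsilon>}. \<bar>f \<theta> x - f \<theta> Med\<bar> \<le> c * (x - Med)\<^sup>2"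
    using f_local by blast
  \<comment> \<open>The quadratic bound squeezes the increment of the density to 0, which is the
    form in which regularity at the median enters the locale.\<close>
  have cont: "isCont (f \<theta>) Med" if \<theta>: "\<theta> \<in> {1..r}" for \<theta>
  proof -
    have lim: "((\<lambda>x. c * (x - Med)\<^sup>2) \<longlongrightarrow> 0) (at Med)" by (auto intro!: tendsto_eq_intros)
    have "\<forall>\<^sub>F x in at Med. x \<in> {Med - \<epsilon><..<Med + \<epsilon>}"
      using \<epsilon>(1) by (intro eventually_at_in_open') auto
    then have "\<forall>\<^sub>F x in at Med. norm (f \<theta> x - f \<theta> Med) \<le> c * (x - Med)\<^sup>2"
      by eventually_elim (use \<epsilon>(2) \<theta> in auto)
    from Lim_null_comparison[OF this lim] show ?thesis
      by (simp add: isCont_def LIM_zero_iff)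
  qed
  interpret prob_space M by fact
  interpret typed_assembly M lam r \<tau> w f Med \<beta> m0
  proof unfold_locales
    fix m \<theta> assume m: "m \<ge> m0" "m > 0" and \<theta>: "\<theta> \<in> {1..r}"
    then have "\<beta> \<le> real (card {k \<in> {1..m}. \<tau> k = \<theta>}) / real m" using \<beta> by blast
    then show "\<beta> * m \<le> card {k \<in> {1..m}. \<tau> k = \<theta>}" using m by (simp add: field_simps)
  qed (use assms \<beta> cont in auto)
  show ?thesis by (rule ratio_limit) fact+
qed

end
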